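(* Let $p$ be a prime, $\nu\in\mathbb{Z}$ and $z\in\mathbb{Q}_p$, and suppose $\mathrm{ord}_p(z)<\nu$ or $z=0$. Then the limit $\mu_p(z,\nu)=\lim_{n\to\infty}F_n(z,\nu)$ exists, and: (i) if $z\in\mathbb{Z}_p$ (where for $z=0$ we take $\nu\ge1$), then $\mu_p(z,\nu)=\dfrac{1}{p^{\nu}+p^{\nu-1}}$; (ii) if $z\notin\mathbb{Z}_p$ with $\mathrm{ord}_p(z)=-\lambda<0$, then $\mu_p(z,\nu)=\dfrac{1}{p^{\nu+2\lambda}+p^{\nu+2\lambda-1}}$; (iii) for $z=0$ and any integer $\nu\ge0$, $\mu_p(0,-\nu)=1-\dfrac{1}{p^{\nu+1}+p^{\nu}}$.
   Context: The Calkin--Wilf tree is the infinite rooted binary tree generated from the root $\frac11$ by giving each vertex labelled $\frac ab$ (reduced) a left child $\frac{a}{a+b}$ and a right child $\frac{a+b}{b}$; its $n$th generation $\mathcal{CW}^{(n)}$ is the multiset of the $2^{n-1}$ labels at distance $n-1$ from the root. For a prime $p$, $z\in\mathbb{Q}_p$ and $\nu\in\mathbb{Z}$, put $F_n(z,\nu)=2^{1-n}\#\{\frac ab\in\mathcal{CW}^{(n)}:\ \mathrm{ord}_p(\frac ab-z)\ge\nu\}$, where $\mathrm{ord}_p$ is the $p$-adic valuation, and $\mu_p(z,\nu)=\lim_{n\to\infty}F_n(z,\nu)$. *)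

theory Defs
  imports
    "HOL-Library.Multiset"
    "HOL-Library.Extended_Real"
    "HOL-Computational_Algebra.Primes"
    "HOL-Algebra.QuotRing"
begin

section \<open>The Calkin--Wilf tree\<close>

text \<open>
  Vertices are words over \<^typ>\<open>bool\<close>, read from the vertex up to the root: the root is \<^term>\<open>[]\<close>
  and the left and right children of \<open>w\<close> are \<open>False # w\<close> and \<open>True # w\<close>, so the length of a
  word is its distance from the root.  The function \<^const>\<open>quotient_of\<close> returns numerator and
  denominator of the reduced fraction.
\<close>

definition cw_left :: "rat \<Rightarrow> rat" where
  "cw_left x = (let (a, b) = quotient_of x in Fract a (a + b))"

definition cw_right :: "rat \<Rightarrow> rat" where
  "cw_right x = (let (a, b) = quotient_of x in Fract (a + b) b)"

fun cw_label :: "bool list \<Rightarrow> rat" where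
  "cw_label [] = 1"
| "cw_label (d # w) = (if d then cw_right (cw_label w) else cw_left (cw_label w))"

text \<open>Generations are counted from 1; generation 0 is empty.\<close>

definition cw_gen :: "nat \<Rightarrow> rat multiset" where
  "cw_gen n = image_mset cw_label (mset_set {w. Suc (length w) = n})"


section \<open>The field of $p$-adic numbers\<close>

definition rat_ord :: "nat \<Rightarrow> rat \<Rightarrow> ereal" where
  "rat_ord p x =
     (if x = 0 then \<infinity>
      else let (a, b) = quotient_of x
           in ereal (real (multiplicity (int p) a) - real (multiplicity (int p) b)))"

text \<open>
  The field $\mathbf{Q}_p$ is the completion of the rationals: the ring of $p$-adic Cauchy
  sequences of rationals modulo the ideal of null sequences.
\<close>

definition padic_Cauchy :: "nat \<Rightarrow> (nat \<Rightarrow> rat) \<Rightarrow> bool" where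
  "padic_Cauchy p X \<longleftrightarrow>
     (\<forall>K::int. \<exists>N. \<forall>m\<ge>N. \<forall>n\<ge>N. ereal (of_int K) \<le> rat_ord p (X m - X n))"

definition padic_null :: "nat \<Rightarrow> (nat \<Rightarrow> rat) set" where
  "padic_null p = {X. \<forall>K::int. \<exists>N. \<forall>n\<ge>N. ereal (of_int K) \<le> rat_ord p (X n)}"

definition Cauchy_ring :: "nat \<Rightarrow> (nat \<Rightarrow> rat) ring" where
  "Cauchy_ring p =
     \<lparr>carrier = {X. padic_Cauchy p X},
      mult = (\<lambda>X Y n. X n * Y n), one = (\<lambda>n. 1),
      zero = (\<lambda>n. 0), add = (\<lambda>X Y n. X n + Y n)\<rparr>"

definition Qp :: "nat \<Rightarrow> (nat \<Rightarrow> rat) set ring" where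
  "Qp p = Cauchy_ring p Quot padic_null p"

definition Qp_of_rat :: "nat \<Rightarrow> rat \<Rightarrow> (nat \<Rightarrow> rat) set" where
  "Qp_of_rat p q = padic_null p +>\<^bsub>Cauchy_ring p\<^esub> (\<lambda>n. q)"

text \<open>
  The valuation is extended to $\mathbf{Q}_p$ by continuity.  Existence and uniqueness of the
  limit are shown in \<open>padic_ord_coset\<close> below.
\<close>

definition padic_ord :: "nat \<Rightarrow> (nat \<Rightarrow> rat) set \<Rightarrow> ereal" where
  "padic_ord p z = (THE v. \<forall>X\<in>z. (\<lambda>n. rat_ord p (X n)) \<longlonglongrightarrow> v)"

definition Zp :: "nat \<Rightarrow> (nat \<Rightarrow> rat) set set" where
  "Zp p = {z \<in> carrier (Qp p). 0 \<le> padic_ord p z}"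


section \<open>The distribution of the generations\<close>

definition cw_freq :: "nat \<Rightarrow> nat \<Rightarrow> (nat \<Rightarrow> rat) set \<Rightarrow> int \<Rightarrow> real" where
  "cw_freq p n z \<nu> =
     2 powi (1 - int n) *
     real (size (filter_mset
       (\<lambda>q. ereal (of_int \<nu>) \<le> padic_ord p (Qp_of_rat p q \<ominus>\<^bsub>Qp p\<^esub> z)) (cw_gen n)))"

definition cw_mu :: "nat \<Rightarrow> (nat \<Rightarrow> rat) set \<Rightarrow> int \<Rightarrow> real" where
  "cw_mu p z \<nu> = lim (\<lambda>n. cw_freq p n z \<nu>)"


section \<open>The construction is well defined\<close>

lemma rat_ord_0 [simp]: "rat_ord p 0 = \<infinity>"
  by (simp add: rat_ord_def)

lemma rat_ord_Fract:
  assumes "prime p" "a \<noteq> 0" "b \<noteq> 0"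
  shows "rat_ord p (Fract a b) = ereal (real (multiplicity (int p) a) - real (multiplicity (int p) b))"
proof -
  obtain c d where cd: "quotient_of (Fract a b) = (c, d)" by fastforce
  have d: "d > 0" using quotient_of_denom_pos[OF cd] .
  have eq: "Fract c d = Fract a b" using quotient_of_eq[OF cd] .
  have nz: "Fract a b \<noteq> 0" using assms by (simp add: Fract_of_int_quotient)
  have c: "c \<noteq> 0" using eq nz by (auto simp: rat_number_collapse)
  have cross: "c * b = a * d" using eq d assms by (simp add: eq_rat)
  have pe: "prime_elem (int p)" using assms by simp
  have "multiplicity (int p) (c * b) = multiplicity (int p) c + multiplicity (int p) b"
    using pe c assms(3) by (rule prime_elem_multiplicity_mult_distrib)
  moreover have "multiplicity (int p) (a * d) = multiplicity (int p) a + multiplicity (int p) d"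
    using pe assms(2) d by (intro prime_elem_multiplicity_mult_distrib) auto
  ultimately have "multiplicity (int p) c + multiplicity (int p) b
      = multiplicity (int p) a + multiplicity (int p) d"
    using cross by simp
  then have "real (multiplicity (int p) c) + real (multiplicity (int p) b)
      = real (multiplicity (int p) a) + real (multiplicity (int p) d)"
    by (metis of_nat_add)
  then show ?thesis using nz cd by (simp add: rat_ord_def)
qed

lemma rat_ord_1 [simp]: "rat_ord p 1 = 0"
  unfolding rat_ord_def quotient_of_number Let_def prod.case multiplicity_one
  by (simp only: one_neq_zero if_False zero_ereal_def diff_self)

lemma rat_ord_eq_infty [simp]: "rat_ord p x = \<infinity> \<longleftrightarrow> x = 0"
  by (auto simp: rat_ord_def split: prod.splits)

lemma rat_ord_minus [simp]: "rat_ord p (- x) = rat_ord p x"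
proof -
  have "multiplicity (int p) (- a) = multiplicity (int p) a" for a
    by (metis multiplicity_normalize_right normalize_int_def abs_minus_cancel)
  then show ?thesis
    by (cases "quotient_of x") (auto simp: rat_ord_def rat_uminus_code Let_def)
qed

lemma rat_ord_diff_commute: "rat_ord p (x - y) = rat_ord p (y - x)"
  by (metis rat_ord_minus minus_diff_eq)

lemma rat_ord_int: "x \<noteq> 0 \<Longrightarrow> \<exists>k::int. rat_ord p x = ereal (of_int k)"
proof (cases "quotient_of x")
  case (Pair a b)
  assume "x \<noteq> 0"
  then show ?thesis using Pair
    by (auto simp: rat_ord_def
      intro!: exI[of _ "int (multiplicity (int p) a) - int (multiplicity (int p) b)"])
qed

lemma rat_ord_lower: "\<exists>k::int. ereal (of_int k) \<le> rat_ord p x"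
  using rat_ord_int[of x p] by (cases "x = 0") (auto intro: eq_refl)

lemma rat_ord_mult:
  assumes "prime p"
  shows "rat_ord p (x * y) = rat_ord p x + rat_ord p y"
proof (cases "x = 0 \<or> y = 0")
  case True
  then show ?thesis
    using rat_ord_lower[of p x] rat_ord_lower[of p y] by auto
next
  case False
  obtain a b c d where x: "x = Fract a b" "b > 0" and y: "y = Fract c d" "d > 0"
    by (metis Rat_cases)
  have nz: "a \<noteq> 0" "c \<noteq> 0" using False x y by (auto simp: rat_number_collapse)
  have pe: "prime_elem (int p)" using assms by simp
  show ?thesis
    using x y nz assms prime_elem_multiplicity_mult_distrib[OF pe]
    by (simp add: rat_ord_Fract)
qed

lemma rat_ord_add:
  assumes p: "prime p" and x: "K \<le> rat_ord p x" and y: "K \<le> rat_ord p y"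
  shows "K \<le> rat_ord p (x + y)"
proof (cases "x = 0 \<or> y = 0 \<or> x + y = 0")
  case True
  then show ?thesis using x y by auto
next
  case False
  obtain a b c d where xf: "x = Fract a b" "b > 0" and yf: "y = Fract c d" "d > 0"
    by (metis Rat_cases)
  have nz: "a \<noteq> 0" "c \<noteq> 0" using False xf yf by (auto simp: rat_number_collapse)
  have pe: "prime_elem (int p)" using p by simp
  let ?m = "multiplicity (int p)"
  have x': "x = Fract (a * d) (b * d)" and y': "y = Fract (c * b) (b * d)"
    using xf yf by (simp_all add: eq_rat)
  have s: "x + y = Fract (a * d + c * b) (b * d)" using xf yf by simp
  have snz: "a * d + c * b \<noteq> 0" using False s by (auto simp: rat_number_collapse)
  have npu: "\<not> is_unit (int p)" using p by auto
  define j where "j = min (?m (a * d)) (?m (c * b))"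
  have "int p ^ j dvd a * d" "int p ^ j dvd c * b"
    unfolding j_def by (auto intro: multiplicity_dvd')
  then have "int p ^ j dvd a * d + c * b" by simp
  then have j: "j \<le> ?m (a * d + c * b)"
    using power_dvd_iff_le_multiplicity snz npu by blast
  have ox: "rat_ord p x = ereal (real (?m (a * d)) - real (?m (b * d)))"
    unfolding x' using xf yf nz by (intro rat_ord_Fract p) auto
  have oy: "rat_ord p y = ereal (real (?m (c * b)) - real (?m (b * d)))"
    unfolding y' using xf yf nz by (intro rat_ord_Fract p) auto
  have os: "rat_ord p (x + y) = ereal (real (?m (a * d + c * b)) - real (?m (b * d)))"
    unfolding s using xf yf snz by (intro rat_ord_Fract p) auto
  have "rat_ord p x \<le> rat_ord p (x + y) \<or> rat_ord p y \<le> rat_ord p (x + y)"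
    unfolding ox oy os using j unfolding j_def by auto
  then show ?thesis using x y by auto
qed

lemma rat_ord_add_eq:
  assumes p: "prime p" and lt: "rat_ord p x < rat_ord p y"
  shows "rat_ord p (x + y) = rat_ord p x"
proof (rule antisym)
  show "rat_ord p x \<le> rat_ord p (x + y)"
    using lt by (intro rat_ord_add p) auto
  show "rat_ord p (x + y) \<le> rat_ord p x"
  proof (rule ccontr)
    assume a: "\<not> ?thesis"
    define K where "K = min (rat_ord p (x + y)) (rat_ord p y)"
    have "K \<le> rat_ord p ((x + y) + - y)"
      by (rule rat_ord_add[OF p]) (auto simp: K_def)
    then show False using a lt by (auto simp: K_def min_def split: if_splits)
  qed
qed

lemma padic_CauchyD:
  assumes "padic_Cauchy p X"
  shows "\<exists>N. \<forall>m\<ge>N. \<forall>n\<ge>N. ereal (of_int K) \<le> rat_ord p (X m - X n)"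
  using assms unfolding padic_Cauchy_def by blast

lemma padic_nullD:
  assumes "X \<in> padic_null p"
  shows "\<exists>N. \<forall>n\<ge>N. ereal (of_int K) \<le> rat_ord p (X n)"
  using assms unfolding padic_null_def by blast

lemma padic_null_Cauchy:
  assumes p: "prime p" and "X \<in> padic_null p"
  shows "padic_Cauchy p X"
  unfolding padic_Cauchy_def
proof
  fix K :: int
  obtain N where N: "\<And>n. n \<ge> N \<Longrightarrow> ereal (of_int K) \<le> rat_ord p (X n)"
    using padic_nullD[OF assms(2), of "K"] by blast
  have "ereal (of_int K) \<le> rat_ord p (X m + - X n)" if "m \<ge> N" "n \<ge> N" for m n
    using N that by (intro rat_ord_add p) auto
  then show "\<exists>N. \<forall>m\<ge>N. \<forall>n\<ge>N. ereal (of_int K) \<le> rat_ord p (X m - X n)" by auto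
qed

lemma padic_Cauchy_lower:
  assumes p: "prime p" and "padic_Cauchy p X"
  shows "\<exists>(B::int) N. \<forall>n\<ge>N. ereal (of_int B) \<le> rat_ord p (X n)"
proof -
  obtain N where N: "\<And>m n. m \<ge> N \<Longrightarrow> n \<ge> N \<Longrightarrow> ereal (of_int 0) \<le> rat_ord p (X m - X n)"
    using padic_CauchyD[OF assms(2), of "0"] by blast
  obtain k :: int where k: "ereal (of_int k) \<le> rat_ord p (X N)" using rat_ord_lower by blast
  have "ereal (of_int (min 0 k)) \<le> rat_ord p ((X n - X N) + X N)" if "n \<ge> N" for n
  proof (rule rat_ord_add[OF p])
    show "ereal (of_int (min 0 k)) \<le> rat_ord p (X n - X N)"
      using N[OF that, of N] by (auto intro: order_trans[rotated])
    show "ereal (of_int (min 0 k)) \<le> rat_ord p (X N)"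
      using k by (auto intro: order_trans[rotated])
  qed
  then have "\<forall>n\<ge>N. ereal (of_int (min 0 k)) \<le> rat_ord p (X n)" by simp
  then show ?thesis by blast
qed

lemma padic_Cauchy_const [simp]: "padic_Cauchy p (\<lambda>n. q)"
  by (simp add: padic_Cauchy_def)

lemma padic_Cauchy_uminus: "padic_Cauchy p X \<Longrightarrow> padic_Cauchy p (\<lambda>n. - X n)"
  unfolding padic_Cauchy_def minus_diff_minus rat_ord_minus .

lemma padic_Cauchy_add:
  assumes p: "prime p" and "padic_Cauchy p X" "padic_Cauchy p Y"
  shows "padic_Cauchy p (\<lambda>n. X n + Y n)"
  unfolding padic_Cauchy_def
proof
  fix K :: int
  obtain N where N: "\<And>m n. m \<ge> N \<Longrightarrow> n \<ge> N \<Longrightarrow> ereal (of_int K) \<le> rat_ord p (X m - X n)"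
    using padic_CauchyD[OF assms(2), of "K"] by blast
  obtain M where M: "\<And>m n. m \<ge> M \<Longrightarrow> n \<ge> M \<Longrightarrow> ereal (of_int K) \<le> rat_ord p (Y m - Y n)"
    using padic_CauchyD[OF assms(3), of "K"] by blast
  have "ereal (of_int K) \<le> rat_ord p ((X m - X n) + (Y m - Y n))"
    if "m \<ge> max N M" "n \<ge> max N M" for m n
    using N M that by (intro rat_ord_add p) auto
  then show "\<exists>N. \<forall>m\<ge>N. \<forall>n\<ge>N. ereal (of_int K) \<le> rat_ord p (X m + Y m - (X n + Y n))"
    by (intro exI[of _ "max N M"]) (auto simp: algebra_simps)
qed

lemma rat_ord_mult_lower:
  assumes "prime p" "ereal (of_int a) \<le> rat_ord p x" "ereal (of_int b) \<le> rat_ord p y"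
  shows "ereal (of_int (a + b)) \<le> rat_ord p (x * y)"
  using add_mono[OF assms(2,3)] assms(1) by (simp add: rat_ord_mult)

lemma padic_Cauchy_mult:
  assumes p: "prime p" and "padic_Cauchy p X" "padic_Cauchy p Y"
  shows "padic_Cauchy p (\<lambda>n. X n * Y n)"
  unfolding padic_Cauchy_def
proof
  fix K :: int
  obtain A N0 where A: "\<And>n. n \<ge> N0 \<Longrightarrow> ereal (of_int A) \<le> rat_ord p (X n)"
    using padic_Cauchy_lower[OF p assms(2)] by blast
  obtain B M0 where B: "\<And>n. n \<ge> M0 \<Longrightarrow> ereal (of_int B) \<le> rat_ord p (Y n)"
    using padic_Cauchy_lower[OF p assms(3)] by blast
  obtain N where N: "\<And>m n. m \<ge> N \<Longrightarrow> n \<ge> N \<Longrightarrow> ereal (of_int (K - B)) \<le> rat_ord p (X m - X n)"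
    using padic_CauchyD[OF assms(2), of "K - B"] by blast
  obtain M where M: "\<And>m n. m \<ge> M \<Longrightarrow> n \<ge> M \<Longrightarrow> ereal (of_int (K - A)) \<le> rat_ord p (Y m - Y n)"
    using padic_CauchyD[OF assms(3), of "K - A"] by blast
  define L where "L = Max {N0, M0, N, M}"
  have L: "N0 \<le> L" "M0 \<le> L" "N \<le> L" "M \<le> L" by (simp_all add: L_def)
  have "ereal (of_int K) \<le> rat_ord p (X m * Y m - X n * Y n)" if "m \<ge> L" "n \<ge> L" for m n
  proof -
    have "ereal (of_int K) \<le> rat_ord p (X m * (Y m - Y n) + Y n * (X m - X n))"
    proof (rule rat_ord_add[OF p])
      show "ereal (of_int K) \<le> rat_ord p (X m * (Y m - Y n))"
        using rat_ord_mult_lower[OF p A M, of m m n] L that by simp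
      show "ereal (of_int K) \<le> rat_ord p (Y n * (X m - X n))"
        using rat_ord_mult_lower[OF p B N, of n m n] L that by simp
    qed
    then show ?thesis by (simp add: algebra_simps)
  qed
  then show "\<exists>N. \<forall>m\<ge>N. \<forall>n\<ge>N. ereal (of_int K) \<le> rat_ord p (X m * Y m - X n * Y n)" by blast
qed

lemma padic_null_mult:
  assumes p: "prime p" and "X \<in> padic_null p" "padic_Cauchy p Y"
  shows "(\<lambda>n. X n * Y n) \<in> padic_null p"
  unfolding padic_null_def
proof (clarify)
  fix K :: int
  obtain B M where B: "\<And>n. n \<ge> M \<Longrightarrow> ereal (of_int B) \<le> rat_ord p (Y n)"
    using padic_Cauchy_lower[OF p assms(3)] by blast
  obtain N where N: "\<And>n. n \<ge> N \<Longrightarrow> ereal (of_int (K - B)) \<le> rat_ord p (X n)"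
    using padic_nullD[OF assms(2), of "K - B"] by blast
  have "ereal (of_int K) \<le> rat_ord p (X n * Y n)" if "n \<ge> max N M" for n
    using rat_ord_mult_lower[OF p N B, of n n] that by simp
  then show "\<exists>N. \<forall>n\<ge>N. ereal (of_int K) \<le> rat_ord p (X n * Y n)" by blast
qed

lemma padic_null_add:
  assumes p: "prime p" and "X \<in> padic_null p" "Y \<in> padic_null p"
  shows "(\<lambda>n. X n + Y n) \<in> padic_null p"
  unfolding padic_null_def
proof (clarify)
  fix K :: int
  obtain M where M: "\<And>n. n \<ge> M \<Longrightarrow> ereal (of_int K) \<le> rat_ord p (Y n)"
    using padic_nullD[OF assms(3), of "K"] by blast
  obtain N where N: "\<And>n. n \<ge> N \<Longrightarrow> ereal (of_int K) \<le> rat_ord p (X n)"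
    using padic_nullD[OF assms(2), of "K"] by blast
  have "ereal (of_int K) \<le> rat_ord p (X n + Y n)" if "n \<ge> max N M" for n
    using N M that by (intro rat_ord_add p) auto
  then show "\<exists>N. \<forall>n\<ge>N. ereal (of_int K) \<le> rat_ord p (X n + Y n)" by blast
qed

lemma padic_Cauchy_not_null:
  assumes p: "prime p" and X: "padic_Cauchy p X" and nn: "X \<notin> padic_null p"
  shows "\<exists>(c::int) N. \<forall>n\<ge>N. rat_ord p (X n) = ereal (of_int c)"
proof -
  obtain K :: int where K: "\<And>N. \<exists>n\<ge>N. rat_ord p (X n) < ereal (of_int K)"
    using nn unfolding padic_null_def by (force simp: not_le)
  obtain N where N: "\<And>m n. m \<ge> N \<Longrightarrow> n \<ge> N \<Longrightarrow> ereal (of_int K) \<le> rat_ord p (X m - X n)"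
    using padic_CauchyD[OF assms(2), of "K"] by blast
  obtain k where k: "k \<ge> N" "rat_ord p (X k) < ereal (of_int K)" using K by blast
  then have "X k \<noteq> 0" by auto
  then obtain c :: int where c: "rat_ord p (X k) = ereal (of_int c)" using rat_ord_int by blast
  have "rat_ord p (X n) = ereal (of_int c)" if "n \<ge> N" for n
  proof -
    have "rat_ord p (X k + (X n - X k)) = rat_ord p (X k)"
      using N[OF that k(1)] k(2) by (intro rat_ord_add_eq p) auto
    then show ?thesis using c by simp
  qed
  then show ?thesis by blast
qed

lemma padic_null_ord_tendsto:
  assumes "X \<in> padic_null p"
  shows "(\<lambda>n. rat_ord p (X n)) \<longlonglongrightarrow> \<infinity>"
  unfolding tendsto_PInfty
proof
  fix r :: real
  obtain N where N: "\<And>n. n \<ge> N \<Longrightarrow> ereal (of_int (\<lfloor>r\<rfloor> + 1)) \<le> rat_ord p (X n)"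
    using padic_nullD[OF assms(1), of "\<lfloor>r\<rfloor> + 1"] by blast
  have "ereal r < ereal (of_int (\<lfloor>r\<rfloor> + 1))" by simp
  then show "\<forall>\<^sub>F n in sequentially. ereal r < rat_ord p (X n)"
    unfolding eventually_sequentially using N less_le_trans by blast
qed

lemma padic_Cauchy_ord_convergent:
  assumes "prime p" "padic_Cauchy p X"
  shows "convergent (\<lambda>n. rat_ord p (X n))"
proof (cases "X \<in> padic_null p")
  case True
  then show ?thesis using padic_null_ord_tendsto convergentI by blast
next
  case False
  then obtain c :: int and N where "\<And>n. n \<ge> N \<Longrightarrow> rat_ord p (X n) = ereal (of_int c)"
    using padic_Cauchy_not_null[OF assms] by blast
  then have "(\<lambda>n. rat_ord p (X n)) \<longlonglongrightarrow> ereal (of_int c)"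
    by (intro tendsto_eventually) (auto simp: eventually_sequentially)
  then show ?thesis by (rule convergentI)
qed

lemma padic_null_add_ord:
  assumes p: "prime p" and X: "padic_Cauchy p X" and h: "h \<in> padic_null p"
    and lim: "(\<lambda>n. rat_ord p (X n)) \<longlonglongrightarrow> v"
  shows "(\<lambda>n. rat_ord p (h n + X n)) \<longlonglongrightarrow> v"
proof (cases "X \<in> padic_null p")
  case True
  have "v = \<infinity>" using padic_null_ord_tendsto[OF True] lim LIMSEQ_unique by blast
  then show ?thesis using padic_null_ord_tendsto[OF padic_null_add[OF p h True]] by simp
next
  case False
  then obtain c :: int and N where N: "\<And>n. n \<ge> N \<Longrightarrow> rat_ord p (X n) = ereal (of_int c)"
    using padic_Cauchy_not_null[OF p X] by blast
  obtain M where M: "\<And>n. n \<ge> M \<Longrightarrow> ereal (of_int (c + 1)) \<le> rat_ord p (h n)"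
    using padic_nullD[OF assms(3), of "c + 1"] by blast
  have "rat_ord p (h n + X n) = rat_ord p (X n)" if "n \<ge> max N M" for n
  proof -
    have "rat_ord p (X n) < ereal (of_int (c + 1))" using N that by simp
    also have "\<dots> \<le> rat_ord p (h n)" using M that by simp
    finally show ?thesis using rat_ord_add_eq[OF p, of "X n" "h n"] by (simp add: add.commute)
  qed
  then have "\<forall>\<^sub>F n in sequentially. rat_ord p (X n) = rat_ord p (h n + X n)"
    by (metis (mono_tags, lifting) eventually_sequentiallyI)
  then show ?thesis using lim tendsto_cong by fast
qed

lemma Cauchy_ring_simps [simp]:
  "carrier (Cauchy_ring p) = {X. padic_Cauchy p X}"
  "X \<otimes>\<^bsub>Cauchy_ring p\<^esub> Y = (\<lambda>n. X n * Y n)"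
  "X \<oplus>\<^bsub>Cauchy_ring p\<^esub> Y = (\<lambda>n. X n + Y n)"
  "\<one>\<^bsub>Cauchy_ring p\<^esub> = (\<lambda>n. 1)"
  "\<zero>\<^bsub>Cauchy_ring p\<^esub> = (\<lambda>n. 0)"
  by (simp_all add: Cauchy_ring_def)

lemma cring_Cauchy_ring:
  assumes p: "prime p"
  shows "cring (Cauchy_ring p)"
proof (rule cringI)
  show "abelian_group (Cauchy_ring p)"
  proof (rule abelian_groupI)
    fix X assume "X \<in> carrier (Cauchy_ring p)"
    then show "\<exists>Y\<in>carrier (Cauchy_ring p). Y \<oplus>\<^bsub>Cauchy_ring p\<^esub> X = \<zero>\<^bsub>Cauchy_ring p\<^esub>"
      by (intro bexI[of _ "\<lambda>n. - X n"]) (auto intro: padic_Cauchy_uminus)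
  qed (auto simp: padic_Cauchy_add[OF p] algebra_simps)
  show "comm_monoid (Cauchy_ring p)"
    by (rule comm_monoidI) (auto simp: padic_Cauchy_mult[OF p] algebra_simps)
qed (auto simp: algebra_simps)

lemma Cauchy_ring_a_inv:
  assumes p: "prime p" and X: "padic_Cauchy p X"
  shows "\<ominus>\<^bsub>Cauchy_ring p\<^esub> X = (\<lambda>n. - X n)"
proof -
  interpret cring "Cauchy_ring p" using cring_Cauchy_ring[OF p] .
  show ?thesis
    using minus_equality[of "\<lambda>n. - X n" X] X padic_Cauchy_uminus[OF X] by simp
qed

lemma ideal_padic_null:
  assumes p: "prime p"
  shows "ideal (padic_null p) (Cauchy_ring p)"
proof -
  interpret cring "Cauchy_ring p" using cring_Cauchy_ring[OF p] .
  show ?thesis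
  proof (rule idealI)
    show "ring (Cauchy_ring p)" by (rule ring_axioms)
    show "subgroup (padic_null p) (add_monoid (Cauchy_ring p))"
    proof (rule add.subgroupI)
      show "padic_null p \<subseteq> carrier (Cauchy_ring p)" by (auto intro: padic_null_Cauchy[OF p])
      have "(\<lambda>n. 0) \<in> padic_null p" by (simp add: padic_null_def)
      then show "padic_null p \<noteq> {}" by blast
      show "\<ominus>\<^bsub>Cauchy_ring p\<^esub> a \<in> padic_null p" if "a \<in> padic_null p" for a
        using that Cauchy_ring_a_inv[OF p padic_null_Cauchy[OF p that]]
        by (simp add: padic_null_def)
    qed (auto intro: padic_null_add[OF p])
  next
    fix a x assume a: "a \<in> padic_null p" and x: "x \<in> carrier (Cauchy_ring p)"
    then have "(\<lambda>n. a n * x n) \<in> padic_null p" using padic_null_mult[OF p] by simp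
    then show "x \<otimes>\<^bsub>Cauchy_ring p\<^esub> a \<in> padic_null p" "a \<otimes>\<^bsub>Cauchy_ring p\<^esub> x \<in> padic_null p"
      by (simp_all add: mult.commute)
  qed
qed

lemma maximalideal_padic_null:
  assumes p: "prime p"
  shows "maximalideal (padic_null p) (Cauchy_ring p)"
proof (rule maximalidealI)
  show "ideal (padic_null p) (Cauchy_ring p)" by (rule ideal_padic_null[OF p])
  have "(\<lambda>n. 1) \<notin> padic_null p"
  proof
    assume "(\<lambda>n. 1) \<in> padic_null p"
    from padic_nullD[OF this, of 1] show False using p by auto
  qed
  then show "carrier (Cauchy_ring p) \<noteq> padic_null p" by auto
next
  fix J assume J: "ideal J (Cauchy_ring p)" "padic_null p \<subseteq> J" "J \<subseteq> carrier (Cauchy_ring p)"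
  interpret J: ideal J "Cauchy_ring p" by fact
  show "J = padic_null p \<or> J = carrier (Cauchy_ring p)"
  proof (rule disjCI)
    assume ne: "J \<noteq> carrier (Cauchy_ring p)"
    show "J = padic_null p"
    proof (rule ccontr)
      assume "J \<noteq> padic_null p"
      then obtain X where X: "X \<in> J" "X \<notin> padic_null p" using J by blast
      then have XC: "padic_Cauchy p X" using J by auto
      obtain c :: int and N where N: "\<And>n. n \<ge> N \<Longrightarrow> rat_ord p (X n) = ereal (of_int c)"
        using padic_Cauchy_not_null[OF p XC X(2)] by blast
      have nz: "X n \<noteq> 0" if "n \<ge> N" for n using N[OF that] by auto
      define Y where "Y = (\<lambda>n. inverse (X n))"
      have Yo: "ereal (of_int (- c)) \<le> rat_ord p (Y n)" if "n \<ge> N" for n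
      proof -
        have "rat_ord p (X n) + rat_ord p (Y n) = 0"
          using nz[OF that] p by (simp flip: rat_ord_mult add: Y_def)
        then show ?thesis using N[OF that] by (cases "rat_ord p (Y n)") auto
      qed
      have YC: "padic_Cauchy p Y"
        unfolding padic_Cauchy_def
      proof
        fix K :: int
        obtain M where M: "\<And>m n. m \<ge> M \<Longrightarrow> n \<ge> M \<Longrightarrow>
            ereal (of_int (K + 2 * c)) \<le> rat_ord p (X m - X n)"
          using padic_CauchyD[OF XC, of "K + 2 * c"] by blast
        have "ereal (of_int K) \<le> rat_ord p (Y m - Y n)" if "m \<ge> max N M" "n \<ge> max N M" for m n
        proof -
          have "Y m - Y n = (X n - X m) * (Y m * Y n)"
            using nz that by (simp add: Y_def field_simps)
          moreover have "ereal (of_int (K + 2 * c + (- c + - c)))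
              \<le> rat_ord p ((X n - X m) * (Y m * Y n))"
            using that by (intro rat_ord_mult_lower p M Yo) auto
          ultimately show ?thesis by simp
        qed
        then show "\<exists>N. \<forall>m\<ge>N. \<forall>n\<ge>N. ereal (of_int K) \<le> rat_ord p (Y m - Y n)" by blast
      qed
      have "(\<lambda>n. 1 - X n * Y n) \<in> padic_null p"
        using nz by (auto simp: padic_null_def Y_def intro!: exI[of _ N])
      moreover have "(\<lambda>n. X n * Y n) \<in> J" using J.I_r_closed[OF X(1), of Y] YC by simp
      ultimately have "(\<lambda>n. (1 - X n * Y n) + X n * Y n) \<in> J"
        using additive_subgroup.a_closed[OF J.is_additive_subgroup, of "\<lambda>n. 1 - X n * Y n" "\<lambda>n. X n * Y n"]
          J(2) by auto
      then have "\<one>\<^bsub>Cauchy_ring p\<^esub> \<in> J" by simp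
      then show False using ne J.one_imp_carrier by blast
    qed
  qed
qed

theorem field_Qp:
  assumes p: "prime p"
  shows "field (Qp p)"
  unfolding Qp_def
  using maximalideal.quotient_is_field[OF maximalideal_padic_null[OF p] cring_Cauchy_ring[OF p]] .

lemma Qp_of_rat_hom:
  assumes p: "prime p"
  shows "Qp_of_rat p x \<in> carrier (Qp p)"
    and "Qp_of_rat p (x + y) = Qp_of_rat p x \<oplus>\<^bsub>Qp p\<^esub> Qp_of_rat p y"
    and "Qp_of_rat p (x * y) = Qp_of_rat p x \<otimes>\<^bsub>Qp p\<^esub> Qp_of_rat p y"
    and "Qp_of_rat p 1 = \<one>\<^bsub>Qp p\<^esub>"
proof -
  interpret I: ideal "padic_null p" "Cauchy_ring p" using ideal_padic_null[OF p] .
  note h = I.rcos_ring_hom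
  show "Qp_of_rat p x \<in> carrier (Qp p)"
    using ring_hom_closed[OF h, of "\<lambda>n. x"] by (simp add: Qp_def Qp_of_rat_def)
  show "Qp_of_rat p (x + y) = Qp_of_rat p x \<oplus>\<^bsub>Qp p\<^esub> Qp_of_rat p y"
    using ring_hom_add[OF h, of "\<lambda>n. x" "\<lambda>n. y"] by (simp add: Qp_def Qp_of_rat_def)
  show "Qp_of_rat p (x * y) = Qp_of_rat p x \<otimes>\<^bsub>Qp p\<^esub> Qp_of_rat p y"
    using ring_hom_mult[OF h, of "\<lambda>n. x" "\<lambda>n. y"] by (simp add: Qp_def Qp_of_rat_def)
  show "Qp_of_rat p 1 = \<one>\<^bsub>Qp p\<^esub>"
    using ring_hom_one[OF h] by (simp add: Qp_def Qp_of_rat_def)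
qed

lemma Qp_cases:
  assumes "z \<in> carrier (Qp p)"
  obtains X where "padic_Cauchy p X" "z = padic_null p +>\<^bsub>Cauchy_ring p\<^esub> X"
  using assms by (auto simp: Qp_def FactRing_def A_RCOSETS_def')

theorem padic_ord_coset:
  assumes p: "prime p" and X: "padic_Cauchy p X"
  shows "(\<lambda>n. rat_ord p (X n)) \<longlonglongrightarrow> padic_ord p (padic_null p +>\<^bsub>Cauchy_ring p\<^esub> X)"
proof -
  let ?z = "padic_null p +>\<^bsub>Cauchy_ring p\<^esub> X"
  obtain v where v: "(\<lambda>n. rat_ord p (X n)) \<longlonglongrightarrow> v"
    using padic_Cauchy_ord_convergent[OF p X] unfolding convergent_def by blast
  have z: "?z = {\<lambda>n. h n + X n | h. h \<in> padic_null p}"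
    by (auto simp: a_r_coset_def')
  have all: "\<forall>Y\<in>?z. (\<lambda>n. rat_ord p (Y n)) \<longlonglongrightarrow> v"
    unfolding z using padic_null_add_ord[OF p X _ v] by auto
  have Xz: "X \<in> ?z"
    unfolding z by (auto simp: padic_null_def intro!: exI[of _ "\<lambda>n. 0"])
  have "padic_ord p ?z = v"
    unfolding padic_ord_def
  proof (rule the_equality)
    show "\<forall>Y\<in>?z. (\<lambda>n. rat_ord p (Y n)) \<longlonglongrightarrow> v" by (rule all)
    show "w = v" if "\<forall>Y\<in>?z. (\<lambda>n. rat_ord p (Y n)) \<longlonglongrightarrow> w" for w
      using that Xz v LIMSEQ_unique by blast
  qed
  then show ?thesis using v by simp
qed

corollary padic_ord_of_rat:
  assumes "prime p"
  shows "padic_ord p (Qp_of_rat p q) = rat_ord p q"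
proof -
  have "(\<lambda>n::nat. rat_ord p q) \<longlonglongrightarrow> padic_ord p (Qp_of_rat p q)"
    using padic_ord_coset[OF assms, of "\<lambda>n. q"] by (simp add: Qp_of_rat_def)
  then show ?thesis using LIMSEQ_const_iff by metis
qed

end

theory Submission
  imports Defs "HOL-Number_Theory.Cong"
begin

text \<open>
  Passing to a child acts on the pair (numerator, denominator) by one of two matrices that generate
  $SL_2(\mathbf{Z})$.  Modulo $p^m$ this is a random walk on the pairs that are primitive modulo \<open>p\<close>
  whose steps are permutations; it is irreducible and aperiodic, so the generations equidistribute
  among the primitive pairs.  For $c \in \mathbf{Z}$ and $m \ge 1$ the condition
  $\mathrm{ord}_p(a/b - c) \ge m$ says that $p^m$ divides $a - cb$, which is satisfied by
  $p^m - p^{m-1}$ of the $p^{2m} - p^{2m-2}$ primitive pairs.  A $p$-adic \<open>z\<close> may be replaced by a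
  rational, and an integral one by an integer; poles and the case $z = 0$, $\nu \le 0$ reduce to
  this by the symmetry $a/b \mapsto b/a$ of the tree.
\<close>

section \<open>Random walks generated by two permutations\<close>

text \<open>The averaging (Markov) operator of the walk that chooses each of the two steps with
  probability 1/2. Its \<open>n\<close>-th iterate at \<open>v\<close> is the expected value of
  \<open>h\<close> after \<open>n\<close> steps from \<open>v\<close>.\<close>

definition walk_avg :: "(bool \<Rightarrow> 'a \<Rightarrow> 'a) \<Rightarrow> ('a \<Rightarrow> real) \<Rightarrow> 'a \<Rightarrow> real" where
  "walk_avg s h v = (h (s False v) + h (s True v)) / 2"

lemma walk_avg_Suc:
  "(walk_avg s ^^ Suc n) h v = ((walk_avg s ^^ n) h (s False v) + (walk_avg s ^^ n) h (s True v)) / 2"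
  by (simp only: funpow.simps comp_apply walk_avg_def)

lemma finite_bool_words [simp]: "finite {w :: bool list. length w = n}"
  using finite_lists_length_eq[of "UNIV :: bool set" n] by simp

lemma card_bool_words [simp]: "card {w :: bool list. length w = n} = 2 ^ n"
  using card_lists_length_eq[of "UNIV :: bool set" n] by simp

lemma sum_bool_words_Suc:
  fixes f :: "bool list \<Rightarrow> real"
  shows "(\<Sum>w | length w = Suc n. f w) = (\<Sum>w | length w = n. f (False # w) + f (True # w))"
proof -
  have eq: "{w :: bool list. length w = Suc n}
      = (#) False ` {w. length w = n} \<union> (#) True ` {w. length w = n}"
    by (auto simp: length_Suc_conv)
  have "(\<Sum>w | length w = Suc n. f w)
      = (\<Sum>w\<in>(#) False ` {w. length w = n}. f w) + (\<Sum>w\<in>(#) True ` {w. length w = n}. f w)"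
    unfolding eq by (rule sum.union_disjoint) auto
  also have "\<dots> = (\<Sum>w | length w = n. f (False # w)) + (\<Sum>w | length w = n. f (True # w))"
    by (subst (1 2) sum.reindex) auto
  finally show ?thesis by (simp add: sum.distrib)
qed

text \<open>Under \<open>foldr\<close> the head of a word is the step performed last. Peeling it off
  replaces \<open>h\<close> by \<open>walk_avg s h\<close> and keeps the starting point, so the
  induction must leave \<open>h\<close> arbitrary.\<close>

lemma sum_words_eq_walk_avg:
  "(\<Sum>w | length w = n. h (foldr s w v)) = 2 ^ n * (walk_avg s ^^ n) h v"
proof (induction n arbitrary: h)
  case 0
  have "{w :: bool list. length w = 0} = {[]}" by auto
  then show ?case by simp
next
  case (Suc n)
  have "(\<Sum>w | length w = Suc n. h (foldr s w v))
      = (\<Sum>w | length w = n. 2 * walk_avg s h (foldr s w v))"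
    by (simp add: sum_bool_words_Suc walk_avg_def del: distrib_left_numeral)
  also have "\<dots> = 2 ^ Suc n * (walk_avg s ^^ n) (walk_avg s h) v"
    by (simp add: Suc.IH flip: sum_distrib_left)
  finally show ?case by (simp only: funpow_Suc_right comp_apply)
qed

locale permutation_walk =
  fixes V :: "'a set" and s :: "bool \<Rightarrow> 'a \<Rightarrow> 'a"
  assumes fin: "finite V" and bij: "bij_betw (s d) V V"
begin

lemma step_closed: "v \<in> V \<Longrightarrow> s d v \<in> V"
  using bij[of d] by (auto simp: bij_betw_def)

lemma foldr_closed: "v \<in> V \<Longrightarrow> foldr s w v \<in> V"
  by (induction w) (auto intro: step_closed)

text \<open>Among the 2^k equally likely words of length k, the word \<open>w\<close> is evaluated
  exactly and the remaining 2^k - 1 are bounded by \<open>B\<close>.\<close>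

lemma walk_avg_upper:
  assumes v: "v \<in> V" and le: "\<And>u. u \<in> V \<Longrightarrow> h u \<le> B"
  shows "(walk_avg s ^^ length w) h v \<le> h (foldr s w v) / 2 ^ length w + (1 - 1 / 2 ^ length w) * B"
proof -
  let ?k = "length w" and ?W = "{w' :: bool list. length w' = length w}"
  have "2 ^ ?k * (walk_avg s ^^ ?k) h v = (\<Sum>w'\<in>?W. h (foldr s w' v))"
    by (simp add: sum_words_eq_walk_avg)
  also have "\<dots> = h (foldr s w v) + (\<Sum>w'\<in>?W - {w}. h (foldr s w' v))"
    by (intro sum.remove) auto
  also have "(\<Sum>w'\<in>?W - {w}. h (foldr s w' v)) \<le> of_nat (card (?W - {w})) * B"
    by (intro sum_bounded_above le foldr_closed v)
  also have "of_nat (card (?W - {w})) = (2 ^ ?k - 1 :: real)"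
    by (subst card_Diff_singleton) (auto simp: of_nat_diff)
  finally have "2 ^ ?k * (walk_avg s ^^ ?k) h v \<le> h (foldr s w v) + (2 ^ ?k - 1) * B" by simp
  then show ?thesis by (simp add: field_simps)
qed

lemma walk_avg_uminus: "(walk_avg s ^^ n) (\<lambda>u. - h u) v = - (walk_avg s ^^ n) h v"
  using sum_words_eq_walk_avg[of "\<lambda>u. - h u" s v n] sum_words_eq_walk_avg[of h s v n]
  by (simp add: sum_negf flip: mult_minus_right)

lemma walk_avg_lower:
  assumes "v \<in> V" and "\<And>u. u \<in> V \<Longrightarrow> A \<le> h u"
  shows "h (foldr s w v) / 2 ^ length w + (1 - 1 / 2 ^ length w) * A \<le> (walk_avg s ^^ length w) h v"
  using walk_avg_upper[of v "\<lambda>u. - h u" "- A" w] assms by (simp add: walk_avg_uminus)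

lemma walk_avg_between:
  assumes "\<And>u. u \<in> V \<Longrightarrow> A \<le> h u \<and> h u \<le> B" and "v \<in> V"
  shows "A \<le> (walk_avg s ^^ n) h v \<and> (walk_avg s ^^ n) h v \<le> B"
  using assms(2)
proof (induction n arbitrary: v)
  case (Suc n)
  have "A \<le> (walk_avg s ^^ n) h (s d v) \<and> (walk_avg s ^^ n) h (s d v) \<le> B" for d
    using Suc step_closed by blast
  from this[of True] this[of False] show ?case by (simp add: walk_avg_Suc del: funpow.simps)
qed (use assms(1) in auto)

text \<open>Each step permutes \<open>V\<close>, so reindexing leaves the sum unchanged: the uniform
  distribution is stationary.\<close>

lemma sum_walk_avg: "(\<Sum>v\<in>V. (walk_avg s ^^ n) h v) = (\<Sum>v\<in>V. h v)"
proof (induction n)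
  case (Suc n)
  have "(\<Sum>v\<in>V. (walk_avg s ^^ n) h (s d v)) = (\<Sum>v\<in>V. (walk_avg s ^^ n) h v)" for d
    using sum.reindex_bij_betw[OF bij] .
  then show ?case using Suc
    by (simp add: walk_avg_Suc sum.distrib del: funpow.simps flip: sum_divide_distrib)
qed simp

text \<open>Doeblin's argument: after \<open>k\<close> steps every starting point gives weight at least \<open>2 ^ - k\<close> to the
  common point \<open>c\<close>, so the oscillation shrinks by the factor \<open>1 - 2 ^ - k\<close>, while the mean over \<open>V\<close> is
  preserved.\<close>

lemma walk_avg_tendsto_mean_common_length:
  assumes c: "\<And>v. v \<in> V \<Longrightarrow> \<exists>w. length w = k \<and> foldr s w v = c" and v: "v \<in> V"
  shows "(\<lambda>n. (walk_avg s ^^ n) h v) \<longlonglongrightarrow> (\<Sum>v\<in>V. h v) / card V"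
proof -
  define q :: real where "q = 1 - 1 / 2 ^ k"
  have q: "0 \<le> q" "q < 1" by (auto simp: q_def)
  define D where "D = Max (h ` V) - Min (h ` V)"
  \<comment> \<open>If the values lie in an interval [A, A + q^n D], then k further steps put them
    into an interval that starts at g(c)/2^k + qA and has length q^(n+1) D, where g is the current
    function.\<close>
  have osc: "\<exists>A. \<forall>u\<in>V. A \<le> (walk_avg s ^^ (k * n)) h u \<and> (walk_avg s ^^ (k * n)) h u \<le> A + q ^ n * D"
    for n
  proof (induction n)
    case 0
    show ?case using fin by (auto simp: D_def intro!: exI[of _ "Min (h ` V)"])
  next
    case (Suc n)
    let ?g = "(walk_avg s ^^ (k * n)) h"
    obtain A where A: "\<And>u. u \<in> V \<Longrightarrow> A \<le> ?g u" "\<And>u. u \<in> V \<Longrightarrow> ?g u \<le> A + q ^ n * D"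
      using Suc by blast
    have eq: "(walk_avg s ^^ (k * Suc n)) h = (walk_avg s ^^ k) ?g"
      by (simp add: funpow_add)
    have "?g c / 2 ^ k + q * A \<le> (walk_avg s ^^ k) ?g u"
      "(walk_avg s ^^ k) ?g u \<le> ?g c / 2 ^ k + q * (A + q ^ n * D)" if u: "u \<in> V" for u
    proof -
      obtain w where w: "length w = k" "foldr s w u = c" using c[OF u] by blast
      show "?g c / 2 ^ k + q * A \<le> (walk_avg s ^^ k) ?g u"
        using walk_avg_lower[OF u, of A ?g w] A w by (simp add: q_def)
      show "(walk_avg s ^^ k) ?g u \<le> ?g c / 2 ^ k + q * (A + q ^ n * D)"
        using walk_avg_upper[OF u, of ?g "A + q ^ n * D" w] A w by (simp add: q_def)
    qed
    then show ?case
      unfolding eq by (intro exI[of _ "?g c / 2 ^ k + q * A"]) (auto simp: algebra_simps)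
  qed
  have cV: "card V > 0" using v fin by (auto simp: card_gt_0_iff)
  \<comment> \<open>From step \<open>k * n\<close> on, averaging keeps all values inside one
    interval of length q^n D. The mean over \<open>V\<close> is preserved, so it lies in the same
    interval.\<close>
  have bound: "\<bar>(walk_avg s ^^ m) h v - (\<Sum>v\<in>V. h v) / card V\<bar> \<le> q ^ n * D" if m: "k * n \<le> m" for m n
  proof -
    obtain A where A: "\<And>u. u \<in> V \<Longrightarrow> A \<le> (walk_avg s ^^ (k * n)) h u \<and>
        (walk_avg s ^^ (k * n)) h u \<le> A + q ^ n * D"
      using osc by blast
    have eq: "(walk_avg s ^^ m) h = (walk_avg s ^^ (m - k * n)) ((walk_avg s ^^ (k * n)) h)"
      using m by (metis comp_apply funpow_add le_add_diff_inverse2)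
    have 1: "A \<le> (walk_avg s ^^ m) h u \<and> (walk_avg s ^^ m) h u \<le> A + q ^ n * D" if "u \<in> V" for u
      unfolding eq using walk_avg_between[OF A that] .
    have "card V * A \<le> (\<Sum>v\<in>V. (walk_avg s ^^ m) h v)"
      by (rule sum_bounded_below) (use 1 in auto)
    moreover have "(\<Sum>v\<in>V. (walk_avg s ^^ m) h v) \<le> card V * (A + q ^ n * D)"
      by (rule sum_bounded_above) (use 1 in auto)
    ultimately have "A \<le> (\<Sum>v\<in>V. h v) / card V" "(\<Sum>v\<in>V. h v) / card V \<le> A + q ^ n * D"
      using cV by (simp_all add: sum_walk_avg field_simps)
    then show ?thesis using 1[OF v] by linarith
  qed
  show ?thesis
  proof (rule LIMSEQ_I)
    fix r :: real assume r: "0 < r"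
    have "(\<lambda>n. q ^ n * D) \<longlonglongrightarrow> 0 * D" using q by (intro tendsto_mult LIMSEQ_realpow_zero) auto
    then have "\<forall>\<^sub>F n in sequentially. q ^ n * D < r" using r by (intro order_tendstoD) auto
    then obtain n where n: "q ^ n * D < r" by (auto simp: eventually_sequentially)
    have "norm ((walk_avg s ^^ m) h v - (\<Sum>v\<in>V. h v) / card V) < r" if "k * n \<le> m" for m
      using bound[OF that] n by simp
    then show "\<exists>N. \<forall>m\<ge>N. norm ((walk_avg s ^^ m) h v - (\<Sum>v\<in>V. h v) / card V) < r" by blast
  qed
qed

text \<open>A fixed point of one of the two steps lets words be padded to a common length.\<close>

lemma walk_avg_tendsto_mean:
  assumes c: "\<And>v. v \<in> V \<Longrightarrow> \<exists>w. foldr s w v = c" and fixp: "s d c = c" and v: "v \<in> V"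
  shows "(\<lambda>n. (walk_avg s ^^ n) h v) \<longlonglongrightarrow> (\<Sum>v\<in>V. h v) / card V"
proof -
  obtain W where W: "\<And>u. u \<in> V \<Longrightarrow> foldr s (W u) u = c" using c by metis
  define k where "k = Max ((\<lambda>u. length (W u)) ` V)"
  have pad: "foldr s (replicate n d) c = c" for n by (induction n) (auto simp: fixp)
  have "\<exists>w. length w = k \<and> foldr s w u = c" if "u \<in> V" for u
  proof -
    have "length (W u) \<le> k" unfolding k_def using fin that by (intro Max_ge) auto
    then show ?thesis
      \<comment> \<open>The padding stands in front of \<open>W u\<close>, hence is performed after
        \<open>c\<close> has been reached.\<close>
      using W[OF that] pad by (intro exI[of _ "replicate (k - length (W u)) d @ W u"]) auto
  qed
  then show ?thesis using v by (rule walk_avg_tendsto_mean_common_length)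
qed

end


section \<open>The walk on primitive residue pairs\<close>

fun cw_step :: "bool \<Rightarrow> int \<times> int \<Rightarrow> int \<times> int" where
  "cw_step d (a, b) = (if d then (a + b, b) else (a, a + b))"

definition reduce_pair :: "int \<Rightarrow> int \<times> int \<Rightarrow> int \<times> int" where
  "reduce_pair M = (\<lambda>(a, b). (a mod M, b mod M))"

definition primitive_pairs :: "int \<Rightarrow> int \<Rightarrow> (int \<times> int) set" where
  "primitive_pairs p M = {(a, b). a \<in> {0..<M} \<and> b \<in> {0..<M} \<and> \<not> (p dvd a \<and> p dvd b)}"

lemma reduce_pair_cw_step: "reduce_pair M (cw_step d (reduce_pair M v)) = reduce_pair M (cw_step d v)"
  by (cases v) (auto simp: reduce_pair_def mod_simps)

text \<open>The steps are linear, so reducing after every step agrees with a single reduction at the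
  end.\<close>

lemma foldr_reduce_pair:
  "foldr (\<lambda>d v. reduce_pair M (cw_step d v)) w (reduce_pair M v) = reduce_pair M (foldr cw_step w v)"
  by (induction w) (auto simp: reduce_pair_cw_step)

lemma reduce_primitive: "v \<in> primitive_pairs p M \<Longrightarrow> reduce_pair M v = v"
  by (auto simp: primitive_pairs_def reduce_pair_def)

lemma finite_primitive_pairs [simp]: "finite (primitive_pairs p M)"
  by (rule finite_subset[of _ "{0..<M} \<times> {0..<M}"]) (auto simp: primitive_pairs_def)

text \<open>Since \<open>p\<close> divides \<open>M\<close>, primitivity can be read off the
  residues, and each step preserves it. Cancellation modulo \<open>M\<close> gives injectivity,
  which on a finite set is enough.\<close>

lemma permutation_walk_primitive:
  assumes "p dvd M" "M > 0"
  shows "permutation_walk (primitive_pairs p M) (\<lambda>d v. reduce_pair M (cw_step d v))"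
proof
  fix d
  let ?V = "primitive_pairs p M" and ?f = "\<lambda>v. reduce_pair M (cw_step d v)"
  have "?f (a, b) \<in> ?V" if "(a, b) \<in> ?V" for a b
    using that assms
    by (cases d) (auto simp: primitive_pairs_def reduce_pair_def dvd_mod_iff dvd_add_right_iff
      dvd_add_left_iff)
  then have "?f ` ?V \<subseteq> ?V" by auto
  moreover have inj: "inj_on ?f ?V"
  proof (rule inj_onI, clarify)
    fix a b a' b'
    assume v: "(a, b) \<in> ?V" "(a', b') \<in> ?V"
      and eq: "?f (a, b) = ?f (a', b')"
    have r: "a mod M = a" "b mod M = b" "a' mod M = a'" "b' mod M = b'"
      using v by (auto simp: primitive_pairs_def)
    show "a = a' \<and> b = b'"
    proof (cases d)
      case True
      then have b: "b = b'" and "[a + b = a' + b] (mod M)"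
        using eq r by (auto simp: reduce_pair_def cong_def)
      then have "[a = a'] (mod M)" by (simp only: cong_add_rcancel)
      then show ?thesis using b r by (simp add: cong_def)
    next
      case False
      then have a: "a = a'" and "[a + b = a + b'] (mod M)"
        using eq r by (auto simp: reduce_pair_def cong_def)
      then have "[b = b'] (mod M)" by (simp only: cong_add_lcancel)
      then show ?thesis using a r by (simp add: cong_def)
    qed
  qed
  ultimately have "?f ` ?V = ?V" by (intro endo_inj_surj) auto
  then show "bij_betw ?f ?V ?V" using inj by (simp add: bij_betw_def)
qed simp

section \<open>Connecting every primitive pair to (0, 1)\<close>

lemma foldr_cw_step_True: "foldr cw_step (replicate i True) (a, b) = (a + int i * b, b)"
  by (induction i) (auto simp: algebra_simps)

lemma foldr_cw_step_False: "foldr cw_step (replicate i False) (a, b) = (a, b + int i * a)"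
  by (induction i) (auto simp: algebra_simps)

text \<open>The path runs modulo \<open>M\<close> through (a, b), (1, b), (1, 1), (0, 1), using a
  block of right steps, then left steps, then right steps.\<close>

lemma reach_0_1_coprime:
  assumes b: "coprime b M" and M: "M > 1"
  shows "\<exists>w. reduce_pair M (foldr cw_step w (a, b)) = (0, 1)"
proof -
  obtain x where x: "[b * x = 1] (mod M)" using b cong_solve_coprime_int by blast
  \<comment> \<open>With \<open>x\<close> the inverse of \<open>b\<close>, this many right steps
    turn \<open>a\<close> into a + (1 - a) = 1.\<close>
  define i where "i = nat ((x * (1 - a)) mod M)"
  define A where "A = a + int i * b"
  have i: "[int i = x * (1 - a)] (mod M)" using M by (simp add: i_def)
  have "[A = a + (x * (1 - a)) * b] (mod M)"
    unfolding A_def by (intro cong_add cong_mult i cong_refl)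
  also have "a + (x * (1 - a)) * b = a + (b * x) * (1 - a)" by (simp add: algebra_simps)
  also have "[\<dots> = a + 1 * (1 - a)] (mod M)"
    by (intro cong_add cong_mult x cong_refl)
  finally have A: "[A = 1] (mod M)" by simp
  define j where "j = nat ((1 - b) mod M)"
  define B where "B = b + int j * A"
  have "[B = b + (1 - b) * 1] (mod M)"
    unfolding B_def j_def using M by (intro cong_add cong_mult A cong_refl) (auto simp: cong_def)
  then have B: "[B = 1] (mod M)" by simp
  \<comment> \<open>Right steps only add, so \<open>M - 1\<close> of them are used to subtract
    1.\<close>
  have "[A + int (nat (M - 1)) * B = 1 + (M - 1) * 1] (mod M)"
    using M by (intro cong_add cong_mult A B) auto
  then have C: "(A + int (nat (M - 1)) * B) mod M = 0" by (simp add: cong_def)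
  have "reduce_pair M (foldr cw_step (replicate (nat (M - 1)) True @ replicate j False @ replicate i True) (a, b))
      = (0, 1)"
    using C B M by (simp add: foldr_cw_step_True foldr_cw_step_False reduce_pair_def cong_def
      del: foldr_replicate flip: A_def B_def)
  then show ?thesis by blast
qed

text \<open>If \<open>p\<close> divides \<open>b\<close>, it does not divide \<open>a\<close>, and
  one initial left step makes the second entry a + b a unit modulo the prime power.\<close>

lemma reach_0_1:
  assumes p: "prime p" and v: "v \<in> primitive_pairs p (p ^ Suc n)"
  shows "\<exists>w. reduce_pair (p ^ Suc n) (foldr cw_step w v) = (0, 1)"
proof -
  obtain a b where ab: "v = (a, b)" by (cases v)
  have M: "p ^ Suc n > 1" using prime_gt_1_int[OF p] by (simp only: one_less_power zero_less_Suc)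
  have cop: "coprime x (p ^ Suc n)" if "\<not> p dvd x" for x
    using that p by (simp add: prime_imp_coprime coprime_commute)
  show ?thesis
  proof (cases "p dvd b")
    case False
    then show ?thesis using reach_0_1_coprime[OF cop M] ab by blast
  next
    case True
    then have "\<not> p dvd a + b" using v ab by (auto simp: primitive_pairs_def dvd_add_left_iff)
    then obtain w where "reduce_pair (p ^ Suc n) (foldr cw_step w (a, a + b)) = (0, 1)"
      using reach_0_1_coprime[OF cop M] by blast
    then show ?thesis using ab by (intro exI[of _ "w @ [False]"]) simp
  qed
qed

section \<open>Counting primitive pairs and those on a line\<close>

lemma multiples_below_eq_image:
  assumes "p > 0"
  shows "{x \<in> {0..<p * m}. p dvd x} = (*) p ` {0..<m :: int}"
proof (intro equalityI subsetI)
  fix x assume x: "x \<in> {x \<in> {0..<p * m}. p dvd x}"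
  then obtain k where k: "x = p * k" by blast
  have "0 \<le> k" "k < m" using x assms by (simp_all add: k zero_le_mult_iff)
  then show "x \<in> (*) p ` {0..<m}" unfolding k by (intro imageI) simp
next
  fix x assume "x \<in> (*) p ` {0..<m}"
  then obtain k where "x = p * k" "k \<in> {0..<m}" by (rule imageE)
  then show "x \<in> {x \<in> {0..<p * m}. p dvd x}" using assms by simp
qed

lemma card_residues: "card {0..<int p ^ n} = p ^ n"
  by (simp only: card_atLeastLessThan_int diff_zero nat_int flip: of_nat_power)

lemma card_multiples:
  assumes "p > 0"
  shows "card {x \<in> {0..<int p ^ Suc n}. int p dvd x} = p ^ n"
  using multiples_below_eq_image[of "int p" "int p ^ n"] assms
  by (simp add: card_image inj_on_def card_residues del: card_atLeastLessThan_int)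

lemma finite_multiples: "finite {x \<in> {0..<M :: int}. p dvd x}"
  by (rule finite_subset[of _ "{0..<M}"]) auto

text \<open>The pairs to be removed from the full square form the square of the set of multiples of
  \<open>p\<close>.\<close>

lemma card_primitive_pairs:
  assumes p: "prime (p :: nat)"
  shows "card (primitive_pairs (int p) (int p ^ Suc n)) = (p ^ Suc n)\<^sup>2 - (p ^ n)\<^sup>2"
proof -
  let ?D = "{x \<in> {0..<int p ^ Suc n}. int p dvd x}"
  have p0: "p > 0" using p prime_gt_0_nat by blast
  have D: "card ?D = p ^ n" using p0 by (rule card_multiples)
  have "primitive_pairs (int p) (int p ^ Suc n)
      = {0..<int p ^ Suc n} \<times> {0..<int p ^ Suc n} - ?D \<times> ?D"
    by (auto simp: primitive_pairs_def)
  then have "card (primitive_pairs (int p) (int p ^ Suc n))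
      = card ({0..<int p ^ Suc n} \<times> {0..<int p ^ Suc n} - ?D \<times> ?D)" by (rule arg_cong)
  also have "\<dots> = card ({0..<int p ^ Suc n} \<times> {0..<int p ^ Suc n}) - card (?D \<times> ?D)"
    by (intro card_Diff_subset finite_cartesian_product finite_multiples) auto
  also have "\<dots> = (p ^ Suc n)\<^sup>2 - (p ^ n)\<^sup>2"
    by (simp only: card_cartesian_product D card_residues power2_eq_square)
  finally show ?thesis .
qed

text \<open>On the line, \<open>p\<close> dividing \<open>b\<close> would force \<open>p\<close> to
  divide \<open>a\<close>. So \<open>b\<close> ranges over the units, and it determines
  \<open>a\<close> as the residue of c b.\<close>

lemma card_primitive_pairs_line:
  assumes p: "prime (p :: nat)"
  shows "card {(a, b) \<in> primitive_pairs (int p) (int p ^ Suc n). int p ^ Suc n dvd a - c * b}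
    = p ^ Suc n - p ^ n"
proof -
  let ?M = "int p ^ Suc n"
  let ?D = "{x \<in> {0..<?M}. int p dvd x}"
  have p0: "p > 0" using p prime_gt_0_nat by blast
  then have M: "?M > 0" by simp
  have D: "card ?D = p ^ n" using p0 by (rule card_multiples)
  have pM: "int p dvd ?M" by simp
  have "{(a, b) \<in> primitive_pairs (int p) ?M. ?M dvd a - c * b}
      = (\<lambda>b. ((c * b) mod ?M, b)) ` ({0..<?M} - ?D)"
  proof (intro equalityI subsetI)
    fix v assume "v \<in> {(a, b) \<in> primitive_pairs (int p) ?M. ?M dvd a - c * b}"
    then obtain a b where v: "v = (a, b)" and ab: "(a, b) \<in> primitive_pairs (int p) ?M"
      and dv: "?M dvd a - c * b" by auto
    have "a mod ?M = (c * b) mod ?M" using dv by (simp only: mod_eq_dvd_iff)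
    then have a: "a = (c * b) mod ?M" using ab by (auto simp: primitive_pairs_def)
    have "int p dvd a - c * b" using dv pM dvd_trans by blast
    then have "int p dvd a" if "int p dvd b" using that by (metis dvd_mult dvd_add diff_add_cancel)
    then have "\<not> int p dvd b" using ab by (auto simp: primitive_pairs_def)
    then show "v \<in> (\<lambda>b. ((c * b) mod ?M, b)) ` ({0..<?M} - ?D)"
      using a v ab unfolding primitive_pairs_def by (intro image_eqI[of _ _ b]) auto
  next
    fix v assume "v \<in> (\<lambda>b. ((c * b) mod ?M, b)) ` ({0..<?M} - ?D)"
    then obtain b where v: "v = ((c * b) mod ?M, b)" and b: "b \<in> {0..<?M} - ?D" by blast
    have "?M dvd (c * b) mod ?M - c * b" by (simp only: mod_mod_trivial flip: mod_eq_dvd_iff)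
    then show "v \<in> {(a, b) \<in> primitive_pairs (int p) ?M. ?M dvd a - c * b}"
      using v b M by (auto simp: primitive_pairs_def)
  qed
  then have "card {(a, b) \<in> primitive_pairs (int p) ?M. ?M dvd a - c * b} = card ({0..<?M} - ?D)"
    by (simp only:) (intro card_image inj_onI, auto)
  also have "\<dots> = card {0..<?M} - card ?D" by (intro card_Diff_subset finite_multiples) auto
  also have "\<dots> = p ^ Suc n - p ^ n"
    by (simp only: D card_residues)
  finally show ?thesis .
qed

lemma words_line_tendsto:
  assumes p: "prime (p :: nat)"
  shows "(\<lambda>n. real (card {w. length w = n \<and>
      (case foldr cw_step w (1, 1) of (a, b) \<Rightarrow> int p ^ Suc m dvd a - c * b)}) / 2 ^ n)
    \<longlonglongrightarrow> 1 / (real p ^ Suc m + real p ^ m)"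
proof -
  let ?M = "int p ^ Suc m" and ?s = "\<lambda>d v. reduce_pair (int p ^ Suc m) (cw_step d v)"
  let ?V = "primitive_pairs (int p) ?M"
  define Q where "Q = (\<lambda>(a, b). ?M dvd a - c * b)"
  define h :: "int \<times> int \<Rightarrow> real" where "h v = of_bool (Q v)" for v
  have pp: "prime (int p)" and p1: "p > 1" using p prime_gt_1_nat by auto
  have M1: "?M > 1" using p1 by (intro one_less_power) auto
  have start: "(1, 1) \<in> ?V" using M1 p1 by (auto simp: primitive_pairs_def)
  interpret permutation_walk ?V ?s
    by (rule permutation_walk_primitive) (use M1 in auto)
  \<comment> \<open>The condition depends on residues only, so the reduced walk decides it for the
    integer pairs of the tree.\<close>
  have Qred: "Q (reduce_pair ?M v) = Q v" for v
  proof (cases v)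
    case (Pair a b)
    have "[a mod ?M - c * (b mod ?M) = a - c * b] (mod ?M)"
      by (intro cong_diff cong_mult cong_refl) simp_all
    then have "(a mod ?M - c * (b mod ?M)) mod ?M = (a - c * b) mod ?M" by (simp only: cong_def)
    then show ?thesis by (simp only: Pair Q_def reduce_pair_def prod.case dvd_eq_mod_eq_0)
  qed
  have lim: "(\<lambda>n. (walk_avg ?s ^^ n) h (1, 1)) \<longlonglongrightarrow> (\<Sum>v\<in>?V. h v) / card ?V"
  \<comment> \<open>The left step sends (0, 1) to (0, 0 + 1), so this pair can serve as the common
    fixed point.\<close>
  proof (rule walk_avg_tendsto_mean[where c = "(0, 1)" and d = False])
    show "\<exists>w. foldr ?s w v = (0, 1)" if "v \<in> ?V" for v
      using reach_0_1[OF pp that] foldr_reduce_pair[of ?M _ v] reduce_primitive[OF that] by simp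
    show "?s False (0, 1) = (0, 1)" using M1 by (simp add: reduce_pair_def)
  qed (rule start)
  have "(walk_avg ?s ^^ n) h (1, 1) = real (card {w. length w = n \<and> Q (foldr cw_step w (1, 1))}) / 2 ^ n"
    for n
  proof -
    have "2 ^ n * (walk_avg ?s ^^ n) h (1, 1) = (\<Sum>w | length w = n. h (foldr ?s w (1, 1)))"
      by (simp add: sum_words_eq_walk_avg)
    also have "\<dots> = (\<Sum>w | length w = n. of_bool (Q (foldr cw_step w (1, 1))))"
      using foldr_reduce_pair[of ?M _ "(1, 1)"] reduce_primitive[OF start] Qred
      by (simp add: h_def)
    also have "\<dots> = real (card {w. length w = n \<and> Q (foldr cw_step w (1, 1))})"
      by (simp add: Collect_conj_eq Int_commute)
    finally show ?thesis by (simp add: field_simps)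
  qed
  \<comment> \<open>The number of primitive pairs is a difference of two squares, and the number of
    pairs on the line is one of its two factors.\<close>
  moreover have "(\<Sum>v\<in>?V. h v) / card ?V = 1 / (real p ^ Suc m + real p ^ m)"
  proof -
    have "?V \<inter> {v. Q v} = {(a, b) \<in> ?V. ?M dvd a - c * b}" by (auto simp: Q_def)
    then have "(\<Sum>v\<in>?V. h v) = real (p ^ Suc m - p ^ m)"
      using card_primitive_pairs_line[OF p, of m c]
      by (simp only: h_def sum_of_bool_eq finite_primitive_pairs)
    moreover have lt: "p ^ m < p ^ Suc m" using p1 by (intro power_strict_increasing) auto
    then have "real ((p ^ Suc m)\<^sup>2 - (p ^ m)\<^sup>2)
        = (real (p ^ Suc m - p ^ m)) * (real p ^ Suc m + real p ^ m)"
      by (simp add: of_nat_diff power2_eq_square algebra_simps mult_le_mono)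
    moreover have "real (p ^ Suc m - p ^ m) > 0" using lt by simp
    ultimately show ?thesis by (simp only: card_primitive_pairs[OF p]) simp
  qed
  ultimately show ?thesis using lim by (simp add: Q_def)
qed


section \<open>From the tree to residue pairs\<close>

text \<open>Both steps preserve coprimality and positivity, so no cancellation ever occurs and
  \<open>quotient_of\<close> returns exactly the pair carried by the integer walk.\<close>

lemma cw_label_eq_Fract:
  assumes "foldr cw_step w (1, 1) = (a, b)"
  shows "a > 0 \<and> b > 0 \<and> coprime a b \<and> cw_label w = Fract a b"
  using assms
proof (induction w arbitrary: a b)
  case Nil
  then show ?case by (simp add: One_rat_def)
next
  case (Cons d w)
  obtain a' b' where ab': "foldr cw_step w (1, 1) = (a', b')" by fastforce
  note IH = Cons.IH[OF ab']
  then have "quotient_of (cw_label w) = (a', b')"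
    by (simp add: quotient_of_Fract normalize_stable)
  moreover have "coprime (a' + b') b'" "coprime a' (a' + b')"
    using IH gcd_add1[of a' b'] gcd_add2[of a' b'] by (simp_all only: coprime_iff_gcd_eq_1)
  ultimately show ?case
    using IH Cons.prems ab' by (auto simp: cw_left_def cw_right_def split: if_splits)
qed

lemma cw_label_pos: "cw_label w > 0"
  using cw_label_eq_Fract[of w] by (cases "foldr cw_step w (1, 1)") (simp add: zero_less_Fract_iff)

text \<open>The starting pair is symmetric, and the two steps are conjugate under the swap of
  coordinates.\<close>

lemma foldr_cw_step_map_Not:
  "foldr cw_step (map Not w) (1, 1) = prod.swap (foldr cw_step w (1, 1))"
proof (induction w)
  case (Cons d w)
  then show ?case by (cases "foldr cw_step w (1, 1)") simp
qed simp

lemma cw_label_map_Not: "cw_label (map Not w) = inverse (cw_label w)"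
proof -
  obtain a b where ab: "foldr cw_step w (1, 1) = (a, b)" by fastforce
  then have "foldr cw_step (map Not w) (1, 1) = (b, a)" by (simp add: foldr_cw_step_map_Not)
  then show ?thesis using ab cw_label_eq_Fract by simp
qed

text \<open>Depth is counted from 0, so index \<open>n\<close> belongs to generation n + 1.
  Predicates on rationals keep p-adic numbers out of the counting.\<close>

definition word_freq :: "(rat \<Rightarrow> bool) \<Rightarrow> nat \<Rightarrow> real" where
  "word_freq Q n = card {w. length w = n \<and> Q (cw_label w)} / 2 ^ n"

lemma word_freq_cong:
  "(\<And>q. q > 0 \<Longrightarrow> Q q \<longleftrightarrow> Q' q) \<Longrightarrow> word_freq Q = word_freq Q'"
  using cw_label_pos by (simp add: word_freq_def fun_eq_iff)

lemma word_freq_inverse: "word_freq (\<lambda>q. Q (inverse q)) = word_freq Q"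
proof
  fix n
  have "bij_betw (map Not) {w. length w = n \<and> Q (inverse (cw_label w))} {w. length w = n \<and> Q (cw_label w)}"
    by (rule bij_betw_byWitness[of _ "map Not"]) (auto simp: cw_label_map_Not comp_def)
  then show "word_freq (\<lambda>q. Q (inverse q)) n = word_freq Q n"
    by (simp add: word_freq_def bij_betw_same_card)
qed

lemma word_freq_Not: "word_freq (\<lambda>q. \<not> Q q) n = 1 - word_freq Q n"
proof -
  let ?A = "{w. length w = n \<and> Q (cw_label w)}"
  have fin: "finite ?A" by (rule finite_subset[OF _ finite_bool_words[of n]]) auto
  have "{w. length w = n \<and> \<not> Q (cw_label w)} = {w. length w = n} - ?A" by auto
  then have "card {w. length w = n \<and> \<not> Q (cw_label w)} = 2 ^ n - card ?A"
    using fin by (simp only:) (subst card_Diff_subset; auto)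
  moreover have "card ?A \<le> 2 ^ n"
    using card_mono[OF finite_bool_words[of n], of ?A] by auto
  ultimately show ?thesis by (simp add: word_freq_def of_nat_diff field_simps)
qed

lemma cw_freq_Suc:
  "cw_freq p (Suc n) z \<nu> =
    word_freq (\<lambda>q. ereal (of_int \<nu>) \<le> padic_ord p (Qp_of_rat p q \<ominus>\<^bsub>Qp p\<^esub> z)) n"
proof -
  have "size (filter_mset Q (cw_gen (Suc n))) = card {w. length w = n \<and> Q (cw_label w)}" for Q
    by (simp add: cw_gen_def filter_mset_image_mset filter_mset_mset_set)
  then show ?thesis
    unfolding cw_freq_def word_freq_def by (simp add: power_int_minus field_simps)
qed


section \<open>Valuations of differences\<close>

lemma rat_ord_Fract_ge_iff:
  assumes p: "prime p" and b: "b \<noteq> 0" "\<not> int p dvd b"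
  shows "ereal (real m) \<le> rat_ord p (Fract a b) \<longleftrightarrow> int p ^ m dvd a"
proof (cases "a = 0")
  case True
  then show ?thesis by (simp add: rat_number_collapse)
next
  case False
  have "\<not> is_unit (int p)" using p by auto
  then show ?thesis
    using False b by (simp add: rat_ord_Fract[OF p] not_dvd_imp_multiplicity_0 power_dvd_iff_le_multiplicity)
qed

lemma rat_ord_Fract_neg:
  assumes p: "prime p" and "a \<noteq> 0" "b \<noteq> 0" "\<not> int p dvd a" "int p dvd b"
  shows "rat_ord p (Fract a b) < 0"
proof -
  have "\<not> is_unit (int p)" using p by auto
  then have "multiplicity (int p) b \<ge> 1"
    using assms power_dvd_iff_le_multiplicity[of b "int p" 1] by simp
  then show ?thesis using assms by (simp add: rat_ord_Fract not_dvd_imp_multiplicity_0)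
qed

text \<open>The difference is (a - cb)/b. If \<open>p\<close> divides \<open>b\<close>, then
  \<open>p\<close> divides neither \<open>a\<close> nor a - cb, and both sides fail; at exponent 0
  the right side would hold instead, whence \<open>Suc m\<close>.\<close>

lemma rat_ord_Fract_minus_int_ge_iff:
  assumes p: "prime p" and ab: "coprime a b" "b > 0"
  shows "ereal (real (Suc m)) \<le> rat_ord p (Fract a b - of_int c) \<longleftrightarrow> int p ^ Suc m dvd a - c * b"
proof -
  have eq: "Fract a b - of_int c = Fract (a - c * b) b"
    using ab by (simp add: Fract_of_int_quotient field_simps)
  show ?thesis
  proof (cases "int p dvd b")
    case False
    then show ?thesis unfolding eq using ab p by (intro rat_ord_Fract_ge_iff) auto
  next
    case True
    have "\<not> int p dvd a"
      using True ab p by (metis coprime_common_divisor not_prime_unit prime_nat_int_transfer)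
    then have na: "\<not> int p dvd a - c * b"
      using True by (metis dvd_mult dvd_add diff_add_cancel)
    then have "rat_ord p (Fract (a - c * b) b) < 0"
      using True ab p by (intro rat_ord_Fract_neg) auto
    moreover have "\<not> int p ^ Suc m dvd a - c * b" using na by (metis dvd_trans dvd_triv_left power_Suc)
    moreover have "(0 :: ereal) \<le> ereal (real (Suc m))" by simp
    ultimately show ?thesis unfolding eq by (meson leD le_less_trans)
  qed
qed

text \<open>The denominator \<open>b\<close> is prime to \<open>p\<close>; if \<open>u\<close>
  inverts it modulo \<open>p ^ m\<close>, the integer a u approximates a/b.\<close>

lemma rat_integral_approx:
  assumes p: "prime p" and x: "0 \<le> rat_ord p x"
  obtains c :: int where "ereal (real m) \<le> rat_ord p (x - of_int c)"
proof -
  obtain a b where ab: "quotient_of x = (a, b)" by fastforce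
  have b: "b > 0" and cop: "coprime a b" and xe: "x = Fract a b"
    using quotient_of_denom_pos[OF ab] quotient_of_coprime[OF ab] quotient_of_div[OF ab]
    by (auto simp: Fract_of_int_quotient)
  have nb: "\<not> int p dvd b"
  proof
    assume d: "int p dvd b"
    then have "\<not> int p dvd a"
      using cop p by (metis coprime_common_divisor not_prime_unit prime_nat_int_transfer)
    then have "rat_ord p x < 0" unfolding xe using d b p by (intro rat_ord_Fract_neg) auto
    then show False using x by simp
  qed
  then have "coprime (int p) b" using p by (intro prime_imp_coprime) auto
  then have "coprime b (int p ^ m)" by (simp add: coprime_commute)
  then obtain u where "[b * u = 1] (mod int p ^ m)" using cong_solve_coprime_int by blast
  then have "[a * (b * u) = a * 1] (mod int p ^ m)" by (intro cong_mult cong_refl)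
  then have dv: "int p ^ m dvd a - (a * u) * b"
    by (simp add: cong_iff_dvd_diff dvd_diff_commute algebra_simps)
  have eq: "x - of_int (a * u) = Fract (a - (a * u) * b) b"
    using b by (simp add: xe Fract_of_int_quotient field_simps)
  show thesis
    by (rule that[of "a * u"]) (use eq dv nb b p in \<open>simp add: rat_ord_Fract_ge_iff\<close>)
qed

text \<open>In an ultrametric every point of a ball is a centre of it.\<close>

lemma rat_ord_diff_ge_cong:
  assumes p: "prime p" and xy: "K \<le> rat_ord p (x - y)"
  shows "K \<le> rat_ord p (q - x) \<longleftrightarrow> K \<le> rat_ord p (q - y)"
proof
  assume "K \<le> rat_ord p (q - x)"
  from rat_ord_add[OF p this xy] show "K \<le> rat_ord p (q - y)" by simp
next
  assume "K \<le> rat_ord p (q - y)"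
  from rat_ord_add[OF p this, of "y - x"] show "K \<le> rat_ord p (q - x)"
    using xy by (simp add: rat_ord_diff_commute[of p y x])
qed

lemma rat_ord_inverse:
  assumes p: "prime p" and x: "x \<noteq> 0"
  shows "rat_ord p (inverse x) = - rat_ord p x"
proof -
  have "rat_ord p x + rat_ord p (inverse x) = 0"
    using x by (simp flip: rat_ord_mult[OF p])
  moreover obtain i j :: int where "rat_ord p x = ereal (of_int i)" "rat_ord p (inverse x) = ereal (of_int j)"
    using rat_ord_int x by (meson inverse_nonzero_iff_nonzero)
  ultimately show ?thesis by simp
qed

text \<open>Because j < \<nu>, closeness forces \<open>q\<close> to have the same valuation
  \<open>j\<close> as \<open>x\<close>. Then 1/q - 1/x = (x - q)/(qx) loses exactly 2j.\<close>

lemma rat_ord_inverse_diff: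
  assumes p: "prime p" and nz: "x \<noteq> 0" "q \<noteq> 0"
    and x: "rat_ord p x = ereal (of_int j)" and j: "j < \<nu>" and le: "ereal (of_int \<nu>) \<le> rat_ord p (q - x)"
  shows "ereal (of_int (\<nu> - 2 * j)) \<le> rat_ord p (inverse q - inverse x)"
proof -
  have "rat_ord p x < ereal (of_int \<nu>)" using x j by simp
  then have "rat_ord p (x + (q - x)) = rat_ord p x"
    using le by (intro rat_ord_add_eq[OF p]) simp
  then have q: "rat_ord p q = ereal (of_int j)" using x by simp
  have "inverse q - inverse x = (x - q) * (inverse q * inverse x)"
    using nz by (simp add: field_simps)
  moreover have "ereal (of_int (\<nu> + (- j + - j))) \<le> rat_ord p ((x - q) * (inverse q * inverse x))"
    using le x q nz p
    by (intro rat_ord_mult_lower) (auto simp: rat_ord_inverse rat_ord_diff_commute[of p x q])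
  ultimately show ?thesis by simp
qed

lemma rat_ord_inverse_diff_iff:
  assumes p: "prime p" and nz: "x \<noteq> 0" "q \<noteq> 0"
    and x: "rat_ord p x = ereal (of_int j)" and j: "j < \<nu>"
  shows "ereal (of_int (\<nu> - 2 * j)) \<le> rat_ord p (inverse q - inverse x)
    \<longleftrightarrow> ereal (of_int \<nu>) \<le> rat_ord p (q - x)"
proof
  assume "ereal (of_int (\<nu> - 2 * j)) \<le> rat_ord p (inverse q - inverse x)"
  moreover have "rat_ord p (inverse x) = ereal (of_int (- j))" using x by (simp add: rat_ord_inverse[OF p nz(1)])
  \<comment> \<open>The converse is the same estimate for the inverses, with -j and \<nu> - 2j in
    place of j and \<nu>.\<close>
  ultimately show "ereal (of_int \<nu>) \<le> rat_ord p (q - x)"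
    using rat_ord_inverse_diff[OF p, of "inverse x" "inverse q" "- j" "\<nu> - 2 * j"] nz j by simp
qed (rule rat_ord_inverse_diff[OF assms])

section \<open>Replacing a p-adic number by a rational approximation\<close>

lemma Qp_of_rat_minus_coset:
  assumes p: "prime p" and X: "padic_Cauchy p X"
  shows "Qp_of_rat p q \<ominus>\<^bsub>Qp p\<^esub> (padic_null p +>\<^bsub>Cauchy_ring p\<^esub> X)
    = padic_null p +>\<^bsub>Cauchy_ring p\<^esub> (\<lambda>n. q - X n)"
proof -
  interpret I: ideal "padic_null p" "Cauchy_ring p" using ideal_padic_null[OF p] .
  interpret h: ring_hom_ring "Cauchy_ring p" "Cauchy_ring p Quot padic_null p"
    "(+>\<^bsub>Cauchy_ring p\<^esub>) (padic_null p)"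
    by (rule I.rcos_ring_hom_ring)
  have "padic_null p +>\<^bsub>Cauchy_ring p\<^esub> ((\<lambda>n. q) \<oplus>\<^bsub>Cauchy_ring p\<^esub> (\<ominus>\<^bsub>Cauchy_ring p\<^esub> X))
    = Qp_of_rat p q \<ominus>\<^bsub>Qp p\<^esub> (padic_null p +>\<^bsub>Cauchy_ring p\<^esub> X)"
    using X h.hom_a_inv[of X] h.hom_add[of "\<lambda>n. q" "\<ominus>\<^bsub>Cauchy_ring p\<^esub> X"] I.a_inv_closed[of X]
    by (simp add: Qp_def Qp_of_rat_def a_minus_def)
  then show ?thesis using X by (simp add: Cauchy_ring_a_inv[OF p])
qed

text \<open>From \<open>N\<close> on the terms differ from \<open>Y N\<close> by valuation at least
  \<nu>. So the valuation is either constant below \<nu> or stays at least \<nu>, and the term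
  \<open>Y N\<close> decides which.\<close>

lemma rat_ord_limit_cases:
  assumes p: "prime p"
    and N: "\<And>n. n \<ge> N \<Longrightarrow> ereal (of_int \<nu>) \<le> rat_ord p (Y n - Y N)"
    and lim: "(\<lambda>n. rat_ord p (Y n)) \<longlonglongrightarrow> v"
  shows "ereal (of_int \<nu>) \<le> v \<longleftrightarrow> ereal (of_int \<nu>) \<le> rat_ord p (Y N)"
    and "v < ereal (of_int \<nu>) \<Longrightarrow> rat_ord p (Y N) = v"
proof -
  have less: "v = rat_ord p (Y N)" if lt: "rat_ord p (Y N) < ereal (of_int \<nu>)"
  proof -
    have "rat_ord p (Y n) = rat_ord p (Y N)" if "n \<ge> N" for n
      using rat_ord_add_eq[OF p less_le_trans[OF lt N[OF that]]] by simp
    then have "(\<lambda>n. rat_ord p (Y n)) \<longlonglongrightarrow> rat_ord p (Y N)"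
      by (intro tendsto_eventually eventually_sequentiallyI[of N])
    then show ?thesis using lim LIMSEQ_unique by blast
  qed
  have ge: "ereal (of_int \<nu>) \<le> v" if ge: "ereal (of_int \<nu>) \<le> rat_ord p (Y N)"
  proof (rule LIMSEQ_le_const[OF lim], intro exI[of _ N] allI impI)
    fix n assume "N \<le> n"
    from rat_ord_add[OF p ge N[OF this]] show "ereal (of_int \<nu>) \<le> rat_ord p (Y n)" by simp
  qed
  show "ereal (of_int \<nu>) \<le> v \<longleftrightarrow> ereal (of_int \<nu>) \<le> rat_ord p (Y N)"
    using less ge by (metis not_le)
  show "rat_ord p (Y N) = v" if "v < ereal (of_int \<nu>)"
    using less ge that by (metis not_le)
qed

text \<open>A term of a representing sequence, taken where the Cauchy bound \<nu> holds, is
  indistinguishable from \<open>z\<close> at precision \<nu>.\<close>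

lemma Qp_rat_approx:
  assumes p: "prime p" and z: "z \<in> carrier (Qp p)"
  obtains x where "\<And>q. ereal (of_int \<nu>) \<le> padic_ord p (Qp_of_rat p q \<ominus>\<^bsub>Qp p\<^esub> z)
      \<longleftrightarrow> ereal (of_int \<nu>) \<le> rat_ord p (q - x)"
    and "padic_ord p z < ereal (of_int \<nu>) \<Longrightarrow> rat_ord p x = padic_ord p z"
proof -
  obtain X where X: "padic_Cauchy p X" and zX: "z = padic_null p +>\<^bsub>Cauchy_ring p\<^esub> X"
    using Qp_cases[OF z] by blast
  obtain N where N: "\<And>m n. m \<ge> N \<Longrightarrow> n \<ge> N \<Longrightarrow> ereal (of_int \<nu>) \<le> rat_ord p (X m - X n)"
    using padic_CauchyD[OF X, of \<nu>] by blast
  then have X_N: "ereal (of_int \<nu>) \<le> rat_ord p (X n - X N)" if "n \<ge> N" for n using that by simp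
  show thesis
  proof (rule that[of "X N"])
    fix q
    have C: "padic_Cauchy p (\<lambda>n. q - X n)"
      using padic_Cauchy_add[OF p padic_Cauchy_const padic_Cauchy_uminus[OF X], of q] by simp
    show "ereal (of_int \<nu>) \<le> padic_ord p (Qp_of_rat p q \<ominus>\<^bsub>Qp p\<^esub> z)
      \<longleftrightarrow> ereal (of_int \<nu>) \<le> rat_ord p (q - X N)"
      unfolding zX Qp_of_rat_minus_coset[OF p X]
      by (rule rat_ord_limit_cases(1)[OF p _ padic_ord_coset[OF p C]]) (use N in simp)
  next
    assume "padic_ord p z < ereal (of_int \<nu>)"
    then show "rat_ord p (X N) = padic_ord p z"
      unfolding zX using rat_ord_limit_cases(2)[OF p X_N padic_ord_coset[OF p X]] by blast
  qed
qed


section \<open>The limiting frequencies\<close>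

lemma word_freq_integral_tendsto:
  assumes p: "prime p" and x: "0 \<le> rat_ord p x" and \<nu>: "1 \<le> \<nu>"
  shows "word_freq (\<lambda>q. ereal (of_int \<nu>) \<le> rat_ord p (q - x))
    \<longlonglongrightarrow> 1 / (real p powi \<nu> + real p powi (\<nu> - 1))"
proof -
  obtain m where m: "\<nu> = int (Suc m)" using that[of "nat (\<nu> - 1)"] \<nu> by simp
  obtain c where c: "ereal (real (Suc m)) \<le> rat_ord p (x - of_int c)"
    using rat_integral_approx[OF p x] by blast
  have "(ereal (of_int \<nu>) \<le> rat_ord p (cw_label w - x))
      \<longleftrightarrow> (case foldr cw_step w (1, 1) of (a, b) \<Rightarrow> int p ^ Suc m dvd a - c * b)" for w
  proof -
    obtain a b where ab: "foldr cw_step w (1, 1) = (a, b)" by fastforce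
    have "(ereal (of_int \<nu>) \<le> rat_ord p (cw_label w - x))
        \<longleftrightarrow> ereal (real (Suc m)) \<le> rat_ord p (Fract a b - of_int c)"
      using rat_ord_diff_ge_cong[OF p c, of "cw_label w"] cw_label_eq_Fract[OF ab] by (simp add: m)
    then show ?thesis
      using rat_ord_Fract_minus_int_ge_iff[OF p, of a b m c] cw_label_eq_Fract[OF ab] by (simp add: ab)
  qed
  then have "word_freq (\<lambda>q. ereal (of_int \<nu>) \<le> rat_ord p (q - x))
      = (\<lambda>n. real (card {w. length w = n \<and>
          (case foldr cw_step w (1, 1) of (a, b) \<Rightarrow> int p ^ Suc m dvd a - c * b)}) / 2 ^ n)"
    unfolding word_freq_def fun_eq_iff by presburger
  moreover have "real p powi \<nu> = real p ^ Suc m" "real p powi (\<nu> - 1) = real p ^ m"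
    by (simp_all add: m power_int_def nat_add_distrib)
  ultimately show ?thesis using words_line_tendsto[OF p, of m c] by simp
qed

text \<open>Inversion moves the pole to 1/x, of valuation l > 0, and raises the precision to \<nu> +
  2l, which exceeds l. The integral case then applies.\<close>

lemma word_freq_pole_tendsto:
  assumes p: "prime p" and x: "rat_ord p x = ereal (of_int (- l))" and l: "0 < l" "- l < \<nu>"
  shows "word_freq (\<lambda>q. ereal (of_int \<nu>) \<le> rat_ord p (q - x))
    \<longlonglongrightarrow> 1 / (real p powi (\<nu> + 2 * l) + real p powi (\<nu> + 2 * l - 1))"
proof -
  have x0: "x \<noteq> 0" using x by auto
  have "word_freq (\<lambda>q. ereal (of_int \<nu>) \<le> rat_ord p (q - x))
      = word_freq (\<lambda>q. ereal (of_int (\<nu> + 2 * l)) \<le> rat_ord p (inverse q - inverse x))"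
    using rat_ord_inverse_diff_iff[OF p x0 _ x l(2)] by (intro word_freq_cong) auto
  also have "\<dots> = word_freq (\<lambda>q. ereal (of_int (\<nu> + 2 * l)) \<le> rat_ord p (q - inverse x))"
    by (rule word_freq_inverse)
  finally show ?thesis
    using word_freq_integral_tendsto[OF p, of "inverse x" "\<nu> + 2 * l"] x l x0
    by (simp add: rat_ord_inverse[OF p])
qed

text \<open>Valuations of nonzero rationals are integers, so ord(q) \<ge> -k is the negation of
  ord(1/q) \<ge> k + 1. Mirror symmetry and complementation reduce this to the integral case at
  0.\<close>

lemma word_freq_neg_tendsto:
  assumes p: "prime p" and k: "0 \<le> k"
  shows "word_freq (\<lambda>q. ereal (of_int (- k)) \<le> rat_ord p q)
    \<longlonglongrightarrow> 1 - 1 / (real p powi (k + 1) + real p powi k)"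
proof -
  have iff: "ereal (of_int (- k)) \<le> rat_ord p q \<longleftrightarrow> \<not> ereal (of_int (k + 1)) \<le> rat_ord p (inverse q - 0)"
    if "q > 0" for q
  proof -
    have q0: "q \<noteq> 0" using that by simp
    then obtain j :: int where "rat_ord p q = ereal (of_int j)" using rat_ord_int by blast
    moreover from this have "rat_ord p (inverse q) = ereal (of_int (- j))"
      using rat_ord_inverse[OF p q0] by simp
    ultimately show ?thesis by (simp only: ereal_less_eq of_int_le_iff diff_zero) linarith
  qed
  have "word_freq (\<lambda>q. ereal (of_int (- k)) \<le> rat_ord p q)
      = word_freq (\<lambda>q. \<not> ereal (of_int (k + 1)) \<le> rat_ord p (inverse q - 0))"
    using iff by (rule word_freq_cong)
  also have "\<dots> = (\<lambda>n. 1 - word_freq (\<lambda>q. ereal (of_int (k + 1)) \<le> rat_ord p (q - 0)) n)"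
    unfolding word_freq_Not
    using word_freq_inverse[of "\<lambda>q. ereal (of_int (k + 1)) \<le> rat_ord p (q - 0)"] by simp
  finally show ?thesis
    using tendsto_diff[OF tendsto_const word_freq_integral_tendsto[OF p, of 0 "k + 1"], of 1] k by simp
qed

lemma cw_freq_tendsto:
  assumes "\<And>q. ereal (of_int \<nu>) \<le> padic_ord p (Qp_of_rat p q \<ominus>\<^bsub>Qp p\<^esub> z) \<longleftrightarrow> Q q"
    and "word_freq Q \<longlonglongrightarrow> r"
  shows "convergent (\<lambda>n. cw_freq p n z \<nu>) \<and> cw_mu p z \<nu> = r"
proof -
  have "(\<lambda>n. cw_freq p (Suc n) z \<nu>) \<longlonglongrightarrow> r"
    using assms by (simp add: cw_freq_Suc)
  then have "(\<lambda>n. cw_freq p n z \<nu>) \<longlonglongrightarrow> r" by (rule LIMSEQ_imp_Suc)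
  then show ?thesis unfolding cw_mu_def by (auto intro: convergentI limI)
qed

lemma padic_ord_minus_zero:
  assumes p: "prime p"
  shows "padic_ord p (Qp_of_rat p q \<ominus>\<^bsub>Qp p\<^esub> \<zero>\<^bsub>Qp p\<^esub>) = rat_ord p q"
proof -
  interpret field "Qp p" using field_Qp[OF p] .
  show ?thesis using Qp_of_rat_hom(1)[OF p] by (simp add: a_minus_def padic_ord_of_rat[OF p])
qed

lemma padic_ord_zero:
  assumes p: "prime p"
  shows "padic_ord p \<zero>\<^bsub>Qp p\<^esub> = \<infinity>"
proof -
  interpret field "Qp p" using field_Qp[OF p] .
  \<comment> \<open>An element equal to its own double is zero.\<close>
  have "Qp_of_rat p 0 \<oplus>\<^bsub>Qp p\<^esub> Qp_of_rat p 0 = Qp_of_rat p 0"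
    using Qp_of_rat_hom(2)[OF p, of 0 0] by simp
  then have "Qp_of_rat p 0 = \<zero>\<^bsub>Qp p\<^esub>" using Qp_of_rat_hom(1)[OF p] by (simp add: add.l_cancel_one')
  then show ?thesis using padic_ord_of_rat[OF p, of 0] by simp
qed

theorem theorem10:
  fixes p :: nat and \<nu> :: int and z :: "(nat \<Rightarrow> rat) set"
  assumes "prime p"
    and "z \<in> carrier (Qp p)"
    and "padic_ord p z < ereal (of_int \<nu>) \<or> z = \<zero>\<^bsub>Qp p\<^esub>"
  shows "convergent (\<lambda>n. cw_freq p n z \<nu>)
    \<and> (z \<in> Zp p \<longrightarrow> (z = \<zero>\<^bsub>Qp p\<^esub> \<longrightarrow> 1 \<le> \<nu>) \<longrightarrow>
         cw_mu p z \<nu> = 1 / (real p powi \<nu> + real p powi (\<nu> - 1)))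
    \<and> (\<forall>l::int. z \<notin> Zp p \<longrightarrow> 0 < l \<longrightarrow> padic_ord p z = ereal (of_int (- l)) \<longrightarrow>
         cw_mu p z \<nu> = 1 / (real p powi (\<nu> + 2 * l) + real p powi (\<nu> + 2 * l - 1)))
    \<and> (z = \<zero>\<^bsub>Qp p\<^esub> \<longrightarrow> (\<forall>k::int. 0 \<le> k \<longrightarrow>
         cw_mu p z (- k) = 1 - 1 / (real p powi (k + 1) + real p powi k)))"
proof (cases "z = \<zero>\<^bsub>Qp p\<^esub>")
  case True
  note p = assms(1)
  have pos: "convergent (\<lambda>n. cw_freq p n z \<nu>') \<and>
      cw_mu p z \<nu>' = 1 / (real p powi \<nu>' + real p powi (\<nu>' - 1))" if "1 \<le> \<nu>'" for \<nu>'
    by (rule cw_freq_tendsto[OF _ word_freq_integral_tendsto[OF p _ that, of 0]])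
      (simp_all add: True padic_ord_minus_zero[OF p])
  have neg: "convergent (\<lambda>n. cw_freq p n z (- k)) \<and>
      cw_mu p z (- k) = 1 - 1 / (real p powi (k + 1) + real p powi k)" if "0 \<le> k" for k
    by (rule cw_freq_tendsto[OF _ word_freq_neg_tendsto[OF p that]])
      (simp add: True padic_ord_minus_zero[OF p])
  \<comment> \<open>For z = 0 every integer \<nu> is allowed: either \<nu> \<ge> 1, or \<nu> = -k
    with k \<ge> 0.\<close>
  have "convergent (\<lambda>n. cw_freq p n z \<nu>)"
    using pos[of \<nu>] neg[of "- \<nu>"] by (cases "1 \<le> \<nu>") auto
  then show ?thesis using pos neg True padic_ord_zero[OF p] by auto
next
  case False
  note p = assms(1)
  then have lt: "padic_ord p z < ereal (of_int \<nu>)" using assms(3) False by simp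
  \<comment> \<open>The rational \<open>x\<close> defines the same ball as \<open>z\<close> and has
    the same valuation; being finite, that valuation is an integer \<open>j\<close>, whose sign
    separates the two remaining cases.\<close>
  obtain x where x: "\<And>q. ereal (of_int \<nu>) \<le> padic_ord p (Qp_of_rat p q \<ominus>\<^bsub>Qp p\<^esub> z)
      \<longleftrightarrow> ereal (of_int \<nu>) \<le> rat_ord p (q - x)" and ordx: "rat_ord p x = padic_ord p z"
    using Qp_rat_approx[OF p assms(2)] lt by metis
  then have "x \<noteq> 0" using lt by auto
  then obtain j :: int where j: "rat_ord p x = ereal (of_int j)" using rat_ord_int by blast
  have j\<nu>: "j < \<nu>" using j ordx lt by simp
  show ?thesis
  proof (cases "0 \<le> j")
    case True
    then have "z \<in> Zp p" using assms(2) j ordx by (simp add: Zp_def flip: zero_ereal_def)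
    then show ?thesis
      using cw_freq_tendsto[OF x word_freq_integral_tendsto[OF p, of x \<nu>]] j j\<nu> True False
      by simp
  next
    case neg: False
    then have "z \<notin> Zp p" using j ordx by (simp add: Zp_def flip: zero_ereal_def)
    moreover have "l = - j" if "padic_ord p z = ereal (of_int (- l))" for l
      using that j ordx by (metis ereal.inject of_int_eq_iff minus_minus)
    ultimately show ?thesis
      using cw_freq_tendsto[OF x word_freq_pole_tendsto[OF p, of x "- j" \<nu>]] j j\<nu> neg False
      by (intro conjI allI impI) simp_all
  qed
qed

end
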